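(* Let $R$ be a non-commutative prime ring of characteristic not two, with center $Z(R)$ and extended centroid $C$. If $R$ admits a centrally-extended Jordan epimorphism $G: R \to R$ such that $[G(x), x] \in Z(R)$ for all $x \in R$, then either $R$ is an order in a central simple algebra of dimension at most $4$ over its center, or there exists $\lambda \in C$ such that $G(x) = \lambda x$ for all $x \in R$.
   Context: Rings are associative (a unit is not assumed), $Z(R)$ denotes the center of $R$, $[x,y] = xy - yx$ and $x \circ y = xy + yx$. The extended centroid $C$ of $R$ is the center of the maximal right ring of quotients $Q_{mr}(R)$ of $R$; the product $\lambda x$ is taken in $Q_{mr}(R)$, which contains $R$. A map $G: R \to R$ (not assumed additive) is a centrally-extended Jordan endomorphism (CE-Jordan endomorphism) if $G(x+y) - G(x) - G(y) \in Z(R)$ and $G(x \circ y) - G(x) \circ G(y) \in Z(R)$ for all $x, y \in R$. A centrally-extended Jordan epimorphism is a surjective CE-Jordan endomorphism. A ring $R$ is an order in a unital ring $A$ if $R$ is a subring of $A$, every regular (non-zero-divisor) element of $R$ is invertible in $A$, and every element of $A$ can be written both as $rs^{-1}$ and as $t^{-1}u$ with $r,s,t,u \in R$ and $s,t$ regular in $R$. *)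

theory Defs
  imports "HOL-Algebra.Algebra"
begin

text \<open>
  The ring \<open>R\<close> is the universe of a type of class \<^class>\<open>ring\<close>, whose objects are associative rings
  without a unit assumption.  The rings constructed from \<open>R\<close>, or asserted to exist, are unital and are
  \<open>HOL-Algebra\<close> records; \<open>R\<close> is related to them by explicit embeddings.
\<close>

section \<open>Rings without unit\<close>

definition rng_center :: "'a::ring set"
  where "rng_center = {z. \<forall>x. z * x = x * z}"

definition commutator :: "'a::ring \<Rightarrow> 'a \<Rightarrow> 'a"
  where "commutator x y = x * y - y * x"

definition jordan_prod :: "'a::ring \<Rightarrow> 'a \<Rightarrow> 'a"
  where "jordan_prod x y = x * y + y * x"

definition prime_rng :: "'a::ring itself \<Rightarrow> bool"
  where "prime_rng _ \<longleftrightarrow>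
    (\<exists>x::'a. x \<noteq> 0) \<and> (\<forall>a b::'a. (\<forall>x. a * x * b = 0) \<longrightarrow> a = 0 \<or> b = 0)"

text \<open>
  The sum below is the \<open>n\<close>-fold sum of \<open>x\<close>; without a unit the library's \<^const>\<open>semiring_char\<close>
  does not apply, but see \<open>rng_char_eq_CHAR\<close>.
\<close>

definition rng_char :: "'a::ring itself \<Rightarrow> nat"
  where "rng_char _ = Gcd {n. \<forall>x::'a. (\<Sum>i<n. x) = 0}"

lemma rng_char_eq_CHAR: "rng_char TYPE('a::ring_1) = CHAR('a)"
proof -
  have "(\<forall>x::'a. (\<Sum>i<n. x) = 0) \<longleftrightarrow> of_nat n = (0::'a)" for n
    by (metis card_lessThan mult.right_neutral mult_zero_left sum_constant)
  then show ?thesis by (simp add: rng_char_def semiring_char_def)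
qed

definition CE_Jordan_endomorphism :: "('a::ring \<Rightarrow> 'a) \<Rightarrow> bool"
  where "CE_Jordan_endomorphism G \<longleftrightarrow>
    (\<forall>x y. G (x + y) - G x - G y \<in> rng_center) \<and>
    (\<forall>x y. G (jordan_prod x y) - jordan_prod (G x) (G y) \<in> rng_center)"

definition CE_Jordan_epimorphism :: "('a::ring \<Rightarrow> 'a) \<Rightarrow> bool"
  where "CE_Jordan_epimorphism G \<longleftrightarrow> CE_Jordan_endomorphism G \<and> surj G"

section \<open>Orders in central simple algebras\<close>

definition ring_center :: "('b, 'm) ring_scheme \<Rightarrow> 'b set"
  where "ring_center A = {z \<in> carrier A. \<forall>x\<in>carrier A. z \<otimes>\<^bsub>A\<^esub> x = x \<otimes>\<^bsub>A\<^esub> z}"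

definition simple_ring :: "('b, 'm) ring_scheme \<Rightarrow> bool"
  where "simple_ring A \<longleftrightarrow> ring A \<and> carrier A \<noteq> {\<zero>\<^bsub>A\<^esub>} \<and>
    (\<forall>I. ideal I A \<longrightarrow> I = {\<zero>\<^bsub>A\<^esub>} \<or> I = carrier A)"

definition central_simple_algebra_of_dim :: "nat \<Rightarrow> ('b, 'm) ring_scheme \<Rightarrow> bool"
  where "central_simple_algebra_of_dim n A \<longleftrightarrow>
    simple_ring A \<and> subfield (ring_center A) A \<and> ring.dimension A n (ring_center A) (carrier A)"

definition regular_element :: "'a::ring \<Rightarrow> bool"
  where "regular_element s \<longleftrightarrow> (\<forall>r. s * r = 0 \<longrightarrow> r = 0) \<and> (\<forall>r. r * s = 0 \<longrightarrow> r = 0)"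

text \<open>\<open>order_in h A\<close>: the embedding \<open>h\<close> identifies \<open>R\<close> with a (not necessarily unital) subring of \<open>A\<close>
  which is an order in \<open>A\<close>.\<close>

definition order_in :: "('a::ring \<Rightarrow> 'b) \<Rightarrow> ('b, 'm) ring_scheme \<Rightarrow> bool"
  where "order_in h A \<longleftrightarrow>
    ring A \<and> inj h \<and> range h \<subseteq> carrier A \<and>
    (\<forall>x y. h (x + y) = h x \<oplus>\<^bsub>A\<^esub> h y) \<and>
    (\<forall>x y. h (x * y) = h x \<otimes>\<^bsub>A\<^esub> h y) \<and>
    (\<forall>s. regular_element s \<longrightarrow> h s \<in> Units A) \<and>
    (\<forall>a\<in>carrier A.
       (\<exists>r s. regular_element s \<and> a = h r \<otimes>\<^bsub>A\<^esub> inv\<^bsub>A\<^esub> (h s)) \<and>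
       (\<exists>t u. regular_element t \<and> a = inv\<^bsub>A\<^esub> (h t) \<otimes>\<^bsub>A\<^esub> h u))"

text \<open>
  HOL cannot quantify existentially over the type of the elements of \<open>A\<close>.  The type \<open>('a \<times> 'a) set\<close> is
  always large enough, an element \<open>a\<close> being determined by the set of pairs \<open>(r, s)\<close> with
  \<open>a = r s\<^sup>-\<^sup>1\<close>: see \<open>order_in_csa_of_dim_type_independent\<close>.
\<close>

definition order_in_csa_of_dim :: "'a::ring itself \<Rightarrow> nat \<Rightarrow> bool"
  where "order_in_csa_of_dim _ n \<longleftrightarrow>
    (\<exists>(A :: ('a \<times> 'a) set ring) (h :: 'a \<Rightarrow> ('a \<times> 'a) set).
       central_simple_algebra_of_dim n A \<and> order_in h A)"

section \<open>The maximal right ring of quotients\<close>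

definition right_ideal :: "'a::ring set \<Rightarrow> bool"
  where "right_ideal J \<longleftrightarrow>
    0 \<in> J \<and> (\<forall>x\<in>J. \<forall>y\<in>J. x - y \<in> J) \<and> (\<forall>x\<in>J. \<forall>r. x * r \<in> J)"

definition dense_right_ideal :: "'a::ring set \<Rightarrow> bool"
  where "dense_right_ideal J \<longleftrightarrow> right_ideal J \<and>
    (\<forall>r1 r2. r1 \<noteq> 0 \<longrightarrow> (\<exists>r. r1 * r \<noteq> 0 \<and> r2 * r \<in> J))"

text \<open>
  A pair \<open>(J, f)\<close> stands for a homomorphism \<open>f\<close> of right \<open>R\<close>-modules from the dense right ideal \<open>J\<close>
  to \<open>R\<close>; values of \<open>f\<close> outside \<open>J\<close> are ignored.  Pairs are identified when they agree on a dense right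
  ideal, and are multiplied by composition.
\<close>

definition dense_homs :: "('a::ring set \<times> ('a \<Rightarrow> 'a)) set"
  where "dense_homs = {(J, f). dense_right_ideal J \<and>
    (\<forall>x\<in>J. \<forall>y\<in>J. f (x + y) = f x + f y) \<and> (\<forall>x\<in>J. \<forall>r. f (x * r) = f x * r)}"

definition dense_hom_eq :: "(('a::ring set \<times> ('a \<Rightarrow> 'a)) \<times> ('a set \<times> ('a \<Rightarrow> 'a))) set"
  where "dense_hom_eq = {((J, f), (K, g)). (J, f) \<in> dense_homs \<and> (K, g) \<in> dense_homs \<and>
    (\<exists>L. dense_right_ideal L \<and> L \<subseteq> J \<inter> K \<and> (\<forall>x\<in>L. f x = g x))}"

abbreviation dense_hom_class :: "'a::ring set \<Rightarrow> ('a \<Rightarrow> 'a) \<Rightarrow> ('a set \<times> ('a \<Rightarrow> 'a)) set"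
  where "dense_hom_class J f \<equiv> dense_hom_eq `` {(J, f)}"

definition Q_mr :: "('a::ring set \<times> ('a \<Rightarrow> 'a)) set ring"
  where "Q_mr = \<lparr>
    carrier = dense_homs // dense_hom_eq,
    monoid.mult = \<lambda>p q. \<Union>(J, f)\<in>p. \<Union>(K, g)\<in>q. dense_hom_class {x \<in> K. g x \<in> J} (\<lambda>x. f (g x)),
    monoid.one = dense_hom_class UNIV (\<lambda>x. x),
    ring.zero = dense_hom_class UNIV (\<lambda>x. 0),
    ring.add = \<lambda>p q. \<Union>(J, f)\<in>p. \<Union>(K, g)\<in>q. dense_hom_class (J \<inter> K) (\<lambda>x. f x + g x)\<rparr>"

definition to_Q_mr :: "'a::ring \<Rightarrow> ('a set \<times> ('a \<Rightarrow> 'a)) set"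
  where "to_Q_mr r = dense_hom_class UNIV (\<lambda>x. r * x)"

definition extended_centroid :: "('a::ring set \<times> ('a \<Rightarrow> 'a)) set set"
  where "extended_centroid = ring_center Q_mr"

section \<open>Consistency of the constructions\<close>

lemma dense_right_idealD:
  assumes "dense_right_ideal J"
  shows "0 \<in> J" "x \<in> J \<Longrightarrow> y \<in> J \<Longrightarrow> x - y \<in> J" "x \<in> J \<Longrightarrow> y \<in> J \<Longrightarrow> x + y \<in> J"
    "x \<in> J \<Longrightarrow> - x \<in> J" "x \<in> J \<Longrightarrow> x * r \<in> J"
    "r1 \<noteq> 0 \<Longrightarrow> \<exists>r. r1 * r \<noteq> 0 \<and> r2 * r \<in> J"
proof -
  have diff: "x - y \<in> J" if "x \<in> J" "y \<in> J" for x y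
    using assms that by (auto simp: dense_right_ideal_def right_ideal_def)
  show 0: "0 \<in> J" "x \<in> J \<Longrightarrow> x * r \<in> J" "r1 \<noteq> 0 \<Longrightarrow> \<exists>r. r1 * r \<noteq> 0 \<and> r2 * r \<in> J"
    using assms by (auto simp: dense_right_ideal_def right_ideal_def)
  show "x \<in> J \<Longrightarrow> y \<in> J \<Longrightarrow> x - y \<in> J" by (rule diff)
  have neg: "- y \<in> J" if "y \<in> J" for y using diff[OF 0(1) that] by simp
  show "x \<in> J \<Longrightarrow> - x \<in> J" by (rule neg)
  show "x \<in> J \<Longrightarrow> y \<in> J \<Longrightarrow> x + y \<in> J" using diff[of x "- y"] neg[of y] by simp
qed

lemma dense_homsD:
  assumes "(J, f) \<in> dense_homs"
  shows "dense_right_ideal J" "x \<in> J \<Longrightarrow> y \<in> J \<Longrightarrow> f (x + y) = f x + f y"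
    "x \<in> J \<Longrightarrow> f (x * r) = f x * r"
    "f 0 = 0" "x \<in> J \<Longrightarrow> y \<in> J \<Longrightarrow> f (x - y) = f x - f y"
proof -
  show J: "dense_right_ideal J"
    and add: "x \<in> J \<Longrightarrow> y \<in> J \<Longrightarrow> f (x + y) = f x + f y"
    and "x \<in> J \<Longrightarrow> f (x * r) = f x * r" for x y
    using assms by (auto simp: dense_homs_def)
  show "f 0 = 0" using add[of 0 0] dense_right_idealD(1)[OF J] by simp
  show "x \<in> J \<Longrightarrow> y \<in> J \<Longrightarrow> f (x - y) = f x - f y"
    using add[of "x - y" y] dense_right_idealD(2)[OF J] by (metis add_diff_cancel diff_add_cancel)
qed

lemma dense_right_ideal_pullback:
  assumes J: "dense_right_ideal J" and g: "(K, g) \<in> dense_homs"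
  shows "dense_right_ideal {x \<in> K. g x \<in> J}"
proof -
  note K = dense_homsD(1)[OF g]
  have "\<exists>r. r1 * r \<noteq> 0 \<and> r2 * r \<in> K \<and> g (r2 * r) \<in> J" if nz: "r1 \<noteq> 0" for r1 r2
  proof -
    obtain r where r: "r1 * r \<noteq> 0" "r2 * r \<in> K" using dense_right_idealD(6)[OF K nz] by blast
    obtain s where s: "r1 * r * s \<noteq> 0" "g (r2 * r) * s \<in> J"
      using dense_right_idealD(6)[OF J r(1)] by blast
    have "g (r2 * (r * s)) = g (r2 * r) * s"
      using dense_homsD(3)[OF g r(2), of s] by (simp add: mult.assoc)
    moreover have "r2 * (r * s) \<in> K"
      using dense_right_idealD(5)[OF K r(2), of s] by (simp add: mult.assoc)
    ultimately show ?thesis using s by (metis mult.assoc)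
  qed
  then show ?thesis
    unfolding dense_right_ideal_def right_ideal_def
    by (auto simp: dense_homsD[OF g] dense_right_idealD(1,2,5)[OF K] dense_right_idealD(1,2,5)[OF J])
qed

lemma dense_right_ideal_Int:
  assumes J: "dense_right_ideal J" and K: "dense_right_ideal K"
  shows "dense_right_ideal (J \<inter> K)"
proof -
  have "(K, \<lambda>x. x) \<in> dense_homs" using K by (auto simp: dense_homs_def)
  moreover have "{x \<in> K. x \<in> J} = J \<inter> K" by auto
  ultimately show ?thesis using dense_right_ideal_pullback[OF J, of K "\<lambda>x. x"] by simp
qed

lemma dense_right_ideal_UNIV:
  assumes "prime_rng TYPE('a::ring)"
  shows "dense_right_ideal (UNIV :: 'a set)"
proof -
  have "\<exists>r. r1 * r \<noteq> 0" if "r1 \<noteq> 0" for r1 :: 'a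
    using assms that unfolding prime_rng_def by (metis mult_zero_left)
  then show ?thesis by (auto simp: dense_right_ideal_def right_ideal_def)
qed

lemma dense_hom_eqI:
  assumes "(J, f) \<in> dense_homs" "(K, g) \<in> dense_homs"
    and "dense_right_ideal L" "L \<subseteq> J \<inter> K" "\<And>x. x \<in> L \<Longrightarrow> f x = g x"
  shows "((J, f), (K, g)) \<in> dense_hom_eq"
  using assms unfolding dense_hom_eq_def by blast

lemma dense_hom_eqE:
  assumes "((J, f), (K, g)) \<in> dense_hom_eq"
  obtains L where "(J, f) \<in> dense_homs" "(K, g) \<in> dense_homs"
    "dense_right_ideal L" "L \<subseteq> J" "L \<subseteq> K" "\<And>x. x \<in> L \<Longrightarrow> f x = g x"
  using assms unfolding dense_hom_eq_def by blast

lemma equiv_dense_hom_eq: "equiv (dense_homs :: ('a::ring set \<times> ('a \<Rightarrow> 'a)) set) dense_hom_eq"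
proof (rule equivI)
  show "dense_hom_eq \<subseteq> (dense_homs :: ('a set \<times> ('a \<Rightarrow> 'a)) set) \<times> dense_homs" by (auto simp: dense_hom_eq_def)
  show "refl_on (dense_homs :: ('a set \<times> ('a \<Rightarrow> 'a)) set) dense_hom_eq"
    by (rule refl_onI) (auto intro: dense_hom_eqI dense_homsD(1))
  show "sym (dense_hom_eq :: (('a set \<times> ('a \<Rightarrow> 'a)) \<times> _) set)" by (rule symI) (auto elim!: dense_hom_eqE intro: dense_hom_eqI)
  show "trans (dense_hom_eq :: (('a set \<times> ('a \<Rightarrow> 'a)) \<times> _) set)"
  proof (rule transI, clarify)
    fix J K M :: "'a set" and f g h :: "'a \<Rightarrow> 'a"
    assume "((J, f), (K, g)) \<in> dense_hom_eq" "((K, g), (M, h)) \<in> dense_hom_eq"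
    then obtain L N where "(J, f) \<in> dense_homs" "(M, h) \<in> dense_homs"
      "dense_right_ideal L" "L \<subseteq> J" "L \<subseteq> K" "\<And>x. x \<in> L \<Longrightarrow> f x = g x"
      "dense_right_ideal N" "N \<subseteq> K" "N \<subseteq> M" "\<And>x. x \<in> N \<Longrightarrow> g x = h x"
      by (elim dense_hom_eqE) blast
    then show "((J, f), (M, h)) \<in> dense_hom_eq"
      by (intro dense_hom_eqI[of J f M h "L \<inter> N"]) (auto intro: dense_right_ideal_Int)
  qed
qed

lemma dense_homs_add:
  assumes f: "(J, f) \<in> dense_homs" and g: "(K, g) \<in> dense_homs"
  shows "(J \<inter> K, \<lambda>x. f x + g x) \<in> dense_homs"
  unfolding dense_homs_def
  by (auto simp: dense_homsD[OF f] dense_homsD[OF g] dense_right_ideal_Int algebra_simps)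

lemma dense_homs_comp:
  assumes f: "(J, f) \<in> dense_homs" and g: "(K, g) \<in> dense_homs"
  shows "({x \<in> K. g x \<in> J}, \<lambda>x. f (g x)) \<in> dense_homs"
  unfolding dense_homs_def
  by (auto simp: dense_homsD[OF f] dense_homsD[OF g] dense_right_ideal_pullback[OF dense_homsD(1)[OF f] g])

lemma dense_hom_class_eq:
  assumes "(J, f) \<in> dense_homs" "(K, g) \<in> dense_homs"
    and "dense_right_ideal L" "L \<subseteq> J \<inter> K" "\<And>x. x \<in> L \<Longrightarrow> f x = g x"
  shows "dense_hom_class J f = dense_hom_class K g"
  using equiv_class_eq[OF equiv_dense_hom_eq] dense_hom_eqI[OF assms] by blast

lemma Q_mr_add_class:
  fixes J K :: "'a::ring set"
  assumes "(J, f) \<in> dense_homs" "(K, g) \<in> dense_homs"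
  shows "dense_hom_class J f \<oplus>\<^bsub>Q_mr\<^esub> dense_hom_class K g = dense_hom_class (J \<inter> K) (\<lambda>x. f x + g x)"
proof -
  let ?F = "\<lambda>(J :: 'a set, f) (K :: 'a set, g). dense_hom_class (J \<inter> K) (\<lambda>x. f x + g x)"
  have "congruent2 dense_hom_eq dense_hom_eq ?F"
  proof (rule congruent2I', unfold split_paired_all)
    fix J J' K K' :: "'a set" and f f' g g' :: "'a \<Rightarrow> 'a"
    assume *: "((J, f), (J', f')) \<in> dense_hom_eq" "((K, g), (K', g')) \<in> dense_hom_eq"
    from *(1) obtain L where L: "(J, f) \<in> dense_homs" "(J', f') \<in> dense_homs"
      "dense_right_ideal L" "L \<subseteq> J" "L \<subseteq> J'" "\<And>x. x \<in> L \<Longrightarrow> f x = f' x" by (elim dense_hom_eqE) blast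
    from *(2) obtain M where M: "(K, g) \<in> dense_homs" "(K', g') \<in> dense_homs"
      "dense_right_ideal M" "M \<subseteq> K" "M \<subseteq> K'" "\<And>x. x \<in> M \<Longrightarrow> g x = g' x" by (elim dense_hom_eqE) blast
    show "?F (J, f) (K, g) = ?F (J', f') (K', g')"
      unfolding prod.case using L M by (intro dense_hom_class_eq[where L = "L \<inter> M"] dense_homs_add dense_right_ideal_Int) auto
  qed
  from UN_equiv_class2[OF equiv_dense_hom_eq equiv_dense_hom_eq this assms]
  show ?thesis by (simp add: Q_mr_def case_prod_unfold)
qed

lemma Q_mr_mult_class:
  fixes J K :: "'a::ring set"
  assumes "(J, f) \<in> dense_homs" "(K, g) \<in> dense_homs"
  shows "dense_hom_class J f \<otimes>\<^bsub>Q_mr\<^esub> dense_hom_class K g =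
    dense_hom_class {x \<in> K. g x \<in> J} (\<lambda>x. f (g x))"
proof -
  let ?F = "\<lambda>(J :: 'a set, f) (K :: 'a set, g). dense_hom_class {x \<in> K. g x \<in> J} (\<lambda>x. f (g x))"
  have "congruent2 dense_hom_eq dense_hom_eq ?F"
  proof (rule congruent2I', unfold split_paired_all)
    fix J J' K K' :: "'a set" and f f' g g' :: "'a \<Rightarrow> 'a"
    assume *: "((J, f), (J', f')) \<in> dense_hom_eq" "((K, g), (K', g')) \<in> dense_hom_eq"
    from *(1) obtain L where L: "(J, f) \<in> dense_homs" "(J', f') \<in> dense_homs"
      "dense_right_ideal L" "L \<subseteq> J" "L \<subseteq> J'" "\<And>x. x \<in> L \<Longrightarrow> f x = f' x" by (elim dense_hom_eqE) blast
    from *(2) obtain M where M: "(K, g) \<in> dense_homs" "(K', g') \<in> dense_homs"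
      "dense_right_ideal M" "M \<subseteq> K" "M \<subseteq> K'" "\<And>x. x \<in> M \<Longrightarrow> g x = g' x" by (elim dense_hom_eqE) blast
    show "?F (J, f) (K, g) = ?F (J', f') (K', g')"
      unfolding prod.case
    proof (rule dense_hom_class_eq[where L = "{x \<in> K. g x \<in> L} \<inter> M"])
      show "dense_right_ideal ({x \<in> K. g x \<in> L} \<inter> M)"
        using L M by (intro dense_right_ideal_Int dense_right_ideal_pullback)
      show "{x \<in> K. g x \<in> L} \<inter> M \<subseteq> {x \<in> K. g x \<in> J} \<inter> {x \<in> K'. g' x \<in> J'}"
        using L(4,5) M(4,5) by (auto simp flip: M(6))
      show "f (g x) = f' (g' x)" if "x \<in> {x \<in> K. g x \<in> L} \<inter> M" for x
        using that by (simp add: L(6) flip: M(6))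
    qed (rule dense_homs_comp[OF L(1) M(1)] dense_homs_comp[OF L(2) M(2)])+
  qed
  from UN_equiv_class2[OF equiv_dense_hom_eq equiv_dense_hom_eq this assms]
  show ?thesis by (simp add: Q_mr_def case_prod_unfold)
qed

lemma carrier_Q_mr: "carrier Q_mr = {dense_hom_class J f |J f. (J, f) \<in> dense_homs}"
  by (auto simp: Q_mr_def quotient_def)

lemma Q_mr_one: "\<one>\<^bsub>Q_mr\<^esub> = dense_hom_class UNIV (\<lambda>x. x)"
  and Q_mr_zero: "\<zero>\<^bsub>Q_mr\<^esub> = dense_hom_class UNIV (\<lambda>x. 0)"
  by (simp_all add: Q_mr_def)

theorem ring_Q_mr:
  assumes "prime_rng TYPE('a::ring)"
  shows "ring (Q_mr :: ('a set \<times> ('a \<Rightarrow> 'a)) set ring)"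
proof -
  let ?Q = "Q_mr :: ('a set \<times> ('a \<Rightarrow> 'a)) set ring"
  note U = dense_right_ideal_UNIV[OF assms]
  have UH: "(UNIV, \<lambda>x::'a. x) \<in> dense_homs" "(UNIV, \<lambda>x::'a. 0) \<in> dense_homs"
    using U by (auto simp: dense_homs_def)
  note cls = Q_mr_add_class Q_mr_mult_class Q_mr_one Q_mr_zero
  note cl = dense_homs_add dense_homs_comp UH
  note D = dense_homsD(1)
  have mem: "dense_hom_class J f \<in> carrier ?Q" if "(J, f) \<in> dense_homs" for J f
    using that by (auto simp: carrier_Q_mr)
  show ?thesis
  proof (rule ringI)
    show "abelian_group ?Q"
    proof (rule abelian_groupI)
      fix p q r assume "p \<in> carrier ?Q" "q \<in> carrier ?Q" "r \<in> carrier ?Q"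
      then obtain J f K g M h where
        pqr: "p = dense_hom_class J f" "q = dense_hom_class K g" "r = dense_hom_class M h" and
        H: "(J, f) \<in> dense_homs" "(K, g) \<in> dense_homs" "(M, h) \<in> dense_homs"
        by (auto simp: carrier_Q_mr)
      show "p \<oplus>\<^bsub>?Q\<^esub> q \<in> carrier ?Q" using H by (auto simp: pqr cls intro!: mem cl)
      show "p \<oplus>\<^bsub>?Q\<^esub> q = q \<oplus>\<^bsub>?Q\<^esub> p" using H by (simp add: pqr cls cl Int_commute add.commute)
      show "p \<oplus>\<^bsub>?Q\<^esub> q \<oplus>\<^bsub>?Q\<^esub> r = p \<oplus>\<^bsub>?Q\<^esub> (q \<oplus>\<^bsub>?Q\<^esub> r)"
        using H by (simp add: pqr cls cl Int_assoc add.assoc)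
      show "\<zero>\<^bsub>?Q\<^esub> \<oplus>\<^bsub>?Q\<^esub> p = p" using H by (simp add: pqr cls cl)
      have neg: "(J, \<lambda>x. - f x) \<in> dense_homs"
        using D[OF H(1)] by (auto simp: dense_homs_def dense_homsD[OF H(1)])
      have "dense_hom_class (J \<inter> J) (\<lambda>x. - f x + f x) = dense_hom_class UNIV (\<lambda>x. 0)"
        using dense_homs_add[OF neg H(1)] UH D[OF H(1)]
        by (intro dense_hom_class_eq[where L = J]) auto
      then have "dense_hom_class J (\<lambda>x. - f x) \<oplus>\<^bsub>?Q\<^esub> p = \<zero>\<^bsub>?Q\<^esub>"
        unfolding pqr Q_mr_add_class[OF neg H(1)] Q_mr_zero .
      then show "\<exists>q\<in>carrier ?Q. q \<oplus>\<^bsub>?Q\<^esub> p = \<zero>\<^bsub>?Q\<^esub>" using mem[OF neg] by blast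
    next
      show "\<zero>\<^bsub>?Q\<^esub> \<in> carrier ?Q" using mem UH by (simp add: cls)
    qed
    show "Group.monoid ?Q"
    proof (rule monoidI)
      fix p q r assume "p \<in> carrier ?Q" "q \<in> carrier ?Q" "r \<in> carrier ?Q"
      then obtain J f K g M h where
        pqr: "p = dense_hom_class J f" "q = dense_hom_class K g" "r = dense_hom_class M h" and
        H: "(J, f) \<in> dense_homs" "(K, g) \<in> dense_homs" "(M, h) \<in> dense_homs"
        by (auto simp: carrier_Q_mr)
      show "p \<otimes>\<^bsub>?Q\<^esub> q \<in> carrier ?Q" using H by (auto simp: pqr cls intro!: mem cl)
      have "{x \<in> M. h x \<in> {x \<in> K. g x \<in> J}} = {x \<in> {x \<in> M. h x \<in> K}. g (h x) \<in> J}" by auto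
      then show "p \<otimes>\<^bsub>?Q\<^esub> q \<otimes>\<^bsub>?Q\<^esub> r = p \<otimes>\<^bsub>?Q\<^esub> (q \<otimes>\<^bsub>?Q\<^esub> r)"
        using H by (simp add: pqr cls cl)
      show "\<one>\<^bsub>?Q\<^esub> \<otimes>\<^bsub>?Q\<^esub> p = p" "p \<otimes>\<^bsub>?Q\<^esub> \<one>\<^bsub>?Q\<^esub> = p" using H by (simp_all add: pqr cls cl)
    next
      show "\<one>\<^bsub>?Q\<^esub> \<in> carrier ?Q" using mem UH by (simp add: cls)
    qed
    fix p q r assume "p \<in> carrier ?Q" "q \<in> carrier ?Q" "r \<in> carrier ?Q"
    then obtain J f K g M h where
      pqr: "p = dense_hom_class J f" "q = dense_hom_class K g" "r = dense_hom_class M h" and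
      H: "(J, f) \<in> dense_homs" "(K, g) \<in> dense_homs" "(M, h) \<in> dense_homs"
      by (auto simp: carrier_Q_mr)
    have "{x \<in> M. h x \<in> J \<inter> K} = {x \<in> M. h x \<in> J} \<inter> {x \<in> M. h x \<in> K}" by auto
    then show "(p \<oplus>\<^bsub>?Q\<^esub> q) \<otimes>\<^bsub>?Q\<^esub> r = p \<otimes>\<^bsub>?Q\<^esub> r \<oplus>\<^bsub>?Q\<^esub> q \<otimes>\<^bsub>?Q\<^esub> r"
      using H by (simp add: pqr cls cl)
    let ?L = "{x \<in> J. f x \<in> M} \<inter> {x \<in> K. g x \<in> M}"
    have comp: "({x \<in> J \<inter> K. f x + g x \<in> M}, \<lambda>x. h (f x + g x)) \<in> dense_homs"
      using dense_homs_comp[OF H(3) dense_homs_add[OF H(1,2)]] .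
    have "dense_hom_class {x \<in> J \<inter> K. f x + g x \<in> M} (\<lambda>x. h (f x + g x)) =
        dense_hom_class ?L (\<lambda>x. h (f x) + h (g x))"
    proof (rule dense_hom_class_eq[where L = ?L])
      show "dense_right_ideal ?L"
        using H by (intro dense_right_ideal_Int dense_right_ideal_pullback D)
      show "(?L, \<lambda>x. h (f x) + h (g x)) \<in> dense_homs"
        using H by (intro dense_homs_add dense_homs_comp)
      show "?L \<subseteq> {x \<in> J \<inter> K. f x + g x \<in> M} \<inter> ?L"
        using dense_right_idealD(3)[OF D[OF H(3)]] by blast
      show "h (f x + g x) = h (f x) + h (g x)" if "x \<in> ?L" for x
        using that dense_homsD(2)[OF H(3)] by blast
    qed (rule comp)
    then show "r \<otimes>\<^bsub>?Q\<^esub> (p \<oplus>\<^bsub>?Q\<^esub> q) = r \<otimes>\<^bsub>?Q\<^esub> p \<oplus>\<^bsub>?Q\<^esub> r \<otimes>\<^bsub>?Q\<^esub> q"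
      using H by (simp add: pqr cls cl)
  qed
qed

theorem to_Q_mr_embedding:
  assumes "prime_rng TYPE('a::ring)"
  shows "inj (to_Q_mr :: 'a \<Rightarrow> _)" "to_Q_mr (x :: 'a) \<in> carrier Q_mr"
    "to_Q_mr (x + y) = to_Q_mr x \<oplus>\<^bsub>Q_mr\<^esub> to_Q_mr (y :: 'a)"
    "to_Q_mr (x * y) = to_Q_mr x \<otimes>\<^bsub>Q_mr\<^esub> to_Q_mr (y :: 'a)"
proof -
  have H: "(UNIV, \<lambda>y. x * y) \<in> dense_homs" for x :: 'a
    using dense_right_ideal_UNIV[OF assms] by (auto simp: dense_homs_def algebra_simps)
  show "inj (to_Q_mr :: 'a \<Rightarrow> _)"
  proof (rule injI)
    fix x y :: 'a assume "to_Q_mr x = to_Q_mr y"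
    then have "((UNIV, \<lambda>z. x * z), (UNIV, \<lambda>z. y * z)) \<in> dense_hom_eq"
      unfolding to_Q_mr_def using eq_equiv_class[OF _ equiv_dense_hom_eq H] by blast
    then obtain L where L: "dense_right_ideal L" "\<And>z. z \<in> L \<Longrightarrow> x * z = y * z"
      by (elim dense_hom_eqE) blast
    show "x = y"
    proof (rule ccontr)
      assume "x \<noteq> y"
      then obtain r where r: "(x - y) * r \<noteq> 0"
        using dense_right_idealD(6)[OF L(1), of "x - y" 0] by auto
      then obtain s where "(x - y) * r * s \<noteq> 0" "r * s \<in> L"
        using dense_right_idealD(6)[OF L(1) r, of r] by blast
      then show False using L(2)[of "r * s"] by (simp add: algebra_simps)
    qed
  qed
  show "to_Q_mr x \<in> carrier Q_mr" using H by (auto simp: to_Q_mr_def carrier_Q_mr)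
  show "to_Q_mr (x + y) = to_Q_mr x \<oplus>\<^bsub>Q_mr\<^esub> to_Q_mr y"
    by (simp add: to_Q_mr_def Q_mr_add_class H distrib_right)
  show "to_Q_mr (x * y) = to_Q_mr x \<otimes>\<^bsub>Q_mr\<^esub> to_Q_mr y"
    by (simp add: to_Q_mr_def Q_mr_mult_class H mult.assoc)
qed

lemma order_in_transport:
  fixes A :: "'b ring" and B :: "'c ring" and h :: "'a::ring \<Rightarrow> 'b"
  assumes B: "ring B" and \<phi>: "\<phi> \<in> ring_iso A B"
    and csa: "central_simple_algebra_of_dim n A" and ord: "order_in h A"
  shows "central_simple_algebra_of_dim n B" "order_in (\<lambda>x. \<phi> (h x)) B"
proof -
  have A: "ring A" and K: "subfield (ring_center A) A"
    and dim: "ring.dimension A n (ring_center A) (carrier A)"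
    and simple: "carrier A \<noteq> {\<zero>\<^bsub>A\<^esub>}" "\<And>I. ideal I A \<Longrightarrow> I = {\<zero>\<^bsub>A\<^esub>} \<or> I = carrier A"
    using csa by (auto simp: central_simple_algebra_of_dim_def simple_ring_def)
  have inj: "inj_on \<phi> (carrier A)" and img: "\<phi> ` carrier A = carrier B" and hom: "\<phi> \<in> ring_hom A B"
    using \<phi> by (auto simp: ring_iso_def bij_betw_def)
  interpret \<phi>: ring_hom_ring A B \<phi> by (rule ring_hom_ringI2[OF A B hom])
  have one_zero: "\<one>\<^bsub>B\<^esub> \<noteq> \<zero>\<^bsub>B\<^esub>"
  proof
    assume "\<one>\<^bsub>B\<^esub> = \<zero>\<^bsub>B\<^esub>"
    then have "\<phi> \<one>\<^bsub>A\<^esub> = \<phi> \<zero>\<^bsub>A\<^esub>" by simp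
    then have "\<one>\<^bsub>A\<^esub> = \<zero>\<^bsub>A\<^esub>" using inj_onD[OF inj] by blast
    then show False using simple(1) \<phi>.R.one_zeroD by blast
  qed
  have center: "ring_center B = \<phi> ` ring_center A"
  proof
    show "\<phi> ` ring_center A \<subseteq> ring_center B"
      unfolding ring_center_def img[symmetric] by (auto simp flip: \<phi>.hom_mult)
    show "ring_center B \<subseteq> \<phi> ` ring_center A"
    proof
      fix z assume z: "z \<in> ring_center B"
      then obtain a where a: "a \<in> carrier A" "z = \<phi> a" unfolding ring_center_def using img by blast
      have "a \<otimes>\<^bsub>A\<^esub> x = x \<otimes>\<^bsub>A\<^esub> a" if "x \<in> carrier A" for x
        using z a that inj_onD[OF inj, of "a \<otimes>\<^bsub>A\<^esub> x" "x \<otimes>\<^bsub>A\<^esub> a"] by (auto simp: ring_center_def)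
      then show "z \<in> \<phi> ` ring_center A" using a by (auto simp: ring_center_def)
    qed
  qed
  have "I = {\<zero>\<^bsub>B\<^esub>} \<or> I = carrier B" if I: "ideal I B" for I
  proof -
    have sub: "I \<subseteq> carrier B" using ideal.Icarr[OF I] by blast
    then have I_eq: "I = \<phi> ` {r \<in> carrier A. \<phi> r \<in> I}" 
      unfolding img[symmetric] by (fastforce simp: subset_iff image_iff)
    from simple(2)[OF \<phi>.ideal_vimage[OF I]] show ?thesis
    proof
      assume "{r \<in> carrier A. \<phi> r \<in> I} = {\<zero>\<^bsub>A\<^esub>}"
      then have "I = \<phi> ` {\<zero>\<^bsub>A\<^esub>}" using I_eq by simp
      then show ?thesis by simp
    next
      assume "{r \<in> carrier A. \<phi> r \<in> I} = carrier A"
      then have "I = \<phi> ` carrier A" using I_eq by simp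
      then show ?thesis using img by simp
    qed
  qed
  moreover have "carrier B \<noteq> {\<zero>\<^bsub>B\<^esub>}" using one_zero by auto
  ultimately have "simple_ring B" using B by (auto simp: simple_ring_def)
  moreover have "subfield (ring_center B) B"
    unfolding center by (rule \<phi>.img_is_subfield(2)[OF K one_zero])
  moreover have "ring.dimension B n (ring_center B) (carrier B)"
    using \<phi>.inj_hom_dimension[OF K one_zero inj dim] unfolding center img .
  ultimately show "central_simple_algebra_of_dim n B"
    by (simp add: central_simple_algebra_of_dim_def)

  have h: "inj h" "range h \<subseteq> carrier A" "\<And>x y. h (x + y) = h x \<oplus>\<^bsub>A\<^esub> h y"
    "\<And>x y. h (x * y) = h x \<otimes>\<^bsub>A\<^esub> h y" "\<And>s. regular_element s \<Longrightarrow> h s \<in> Units A"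
    and frac: "\<And>a. a \<in> carrier A \<Longrightarrow> \<exists>r s. regular_element s \<and> a = h r \<otimes>\<^bsub>A\<^esub> inv\<^bsub>A\<^esub> (h s)"
      "\<And>a. a \<in> carrier A \<Longrightarrow> \<exists>t u. regular_element t \<and> a = inv\<^bsub>A\<^esub> (h t) \<otimes>\<^bsub>A\<^esub> h u"
    using ord unfolding order_in_def by blast+
  have hA: "h x \<in> carrier A" for x using h(2) by blast
  have unit: "\<phi> u \<in> Units B \<and> inv\<^bsub>B\<^esub> (\<phi> u) = \<phi> (inv\<^bsub>A\<^esub> u)" if u: "u \<in> Units A" for u
  proof -
    have i: "\<phi> u \<otimes>\<^bsub>B\<^esub> \<phi> (inv\<^bsub>A\<^esub> u) = \<one>\<^bsub>B\<^esub>" "\<phi> (inv\<^bsub>A\<^esub> u) \<otimes>\<^bsub>B\<^esub> \<phi> u = \<one>\<^bsub>B\<^esub>"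
      using u \<phi>.hom_mult[of u "inv\<^bsub>A\<^esub> u"] \<phi>.hom_mult[of "inv\<^bsub>A\<^esub> u" u] \<phi>.R.Units_closed[OF u]
      by (simp_all del: \<phi>.hom_mult)
    then have "\<phi> u \<in> Units B" using u by (auto simp: Units_def[of B])
    moreover have "\<phi> (inv\<^bsub>A\<^esub> u) = inv\<^bsub>B\<^esub> (\<phi> u)"
      by (rule \<phi>.S.inv_unique') (use u i in auto)
    ultimately show ?thesis by simp
  qed
  show "order_in (\<lambda>x. \<phi> (h x)) B"
    unfolding order_in_def
  proof (intro conjI allI impI ballI)
    show "ring B" by (rule B)
    show "inj (\<lambda>x. \<phi> (h x))" using h(1) inj hA by (auto simp: inj_on_def)
    show "range (\<lambda>x. \<phi> (h x)) \<subseteq> carrier B" using hA by auto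
    show "\<phi> (h (x + y)) = \<phi> (h x) \<oplus>\<^bsub>B\<^esub> \<phi> (h y)" "\<phi> (h (x * y)) = \<phi> (h x) \<otimes>\<^bsub>B\<^esub> \<phi> (h y)" for x y
      using hA by (simp_all add: h)
    show "\<phi> (h s) \<in> Units B" if "regular_element s" for s using unit h(5)[OF that] by blast
    fix b assume "b \<in> carrier B"
    then obtain a where a: "a \<in> carrier A" "b = \<phi> a" using img by blast
    obtain r s where rs: "regular_element s" "a = h r \<otimes>\<^bsub>A\<^esub> inv\<^bsub>A\<^esub> (h s)" using frac(1)[OF a(1)] by blast
    obtain t u where tu: "regular_element t" "a = inv\<^bsub>A\<^esub> (h t) \<otimes>\<^bsub>A\<^esub> h u" using frac(2)[OF a(1)] by blast
    have "b = \<phi> (h r) \<otimes>\<^bsub>B\<^esub> inv\<^bsub>B\<^esub> (\<phi> (h s))" using a rs h(5)[OF rs(1)] hA by (simp add: unit)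
    then show "\<exists>r s. regular_element s \<and> b = \<phi> (h r) \<otimes>\<^bsub>B\<^esub> inv\<^bsub>B\<^esub> (\<phi> (h s))" using rs by blast
    have "b = inv\<^bsub>B\<^esub> (\<phi> (h t)) \<otimes>\<^bsub>B\<^esub> \<phi> (h u)" using a tu h(5)[OF tu(1)] hA by (simp add: unit)
    then show "\<exists>t u. regular_element t \<and> b = inv\<^bsub>B\<^esub> (\<phi> (h t)) \<otimes>\<^bsub>B\<^esub> \<phi> (h u)" using tu by blast
  qed
qed

theorem order_in_csa_of_dim_type_independent:
  fixes A :: "'b ring" and h :: "'a::ring \<Rightarrow> 'b"
  assumes "central_simple_algebra_of_dim n A" "order_in h A"
  shows "order_in_csa_of_dim TYPE('a) n"
proof -
  define \<phi> where "\<phi> a = {(r, s). regular_element s \<and> a = h r \<otimes>\<^bsub>A\<^esub> inv\<^bsub>A\<^esub> (h s)}" for a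
  have A: "ring A" using assms(2) by (simp add: order_in_def)
  have "inj_on \<phi> (carrier A)"
  proof (rule inj_onI)
    fix a b assume "a \<in> carrier A" and eq: "\<phi> a = \<phi> b"
    then obtain r s where "(r, s) \<in> \<phi> a"
      using assms(2) by (auto simp: order_in_def \<phi>_def)
    moreover from this have "(r, s) \<in> \<phi> b" using eq by simp
    ultimately show "a = b" by (simp add: \<phi>_def)
  qed
  then have "\<phi> \<in> ring_iso A (image_ring \<phi> A)" "ring (image_ring \<phi> A)"
    by (rule inj_imp_image_ring_iso, rule ring.inj_imp_image_ring_is_ring[OF A])
  from order_in_transport[OF this(2,1) assms] show ?thesis
    unfolding order_in_csa_of_dim_def by blast
qed

end

(*
  Put H = G - id.  Linearizing [G x, x] in the directions x and x o x shows that it vanishes, so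
  [G x, y] = [x, G y], and as G is onto, the Jordan condition becomes
  [p, y] o H z + [p, z] o H y = 0 for all p, y, z.  Hence H is additive, and (x, y) |-> [x, H y] is a
  biderivation, which makes [x, H y] proportional to [x, y] over the extended centroid.  It follows
  that (H y)^2 is central, and then so is [H x, H y]^2.  If H is not 0, proportionality carries this
  over to Hall's identity: every [x, y]^2 is central.

  Under Hall's identity some noncentral commutator u has u^2 central and nonzero, and there is v
  anticommuting with u for which v^2 is also central and nonzero.  Averaging over the conjugations by
  1, u, v, u v shows that R spans at most four dimensions over its center, so that the localization of
  R at its nonzero central elements is the required central simple algebra.  If H = 0, then
  lambda = 1.
*)
theory Submission
  imports Defs
begin

section \<open>Centralizing Jordan maps\<close>

lemma rng_centerI: "(\<And>x. z * x = x * z) \<Longrightarrow> z \<in> rng_center"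
  by (simp add: rng_center_def)

lemma rng_center_comm: "z \<in> rng_center \<Longrightarrow> z * x = x * z"
  by (simp add: rng_center_def)

lemma rng_center_0: "0 \<in> rng_center"
  by (simp add: rng_center_def)

lemma rng_center_minus: "z \<in> rng_center \<Longrightarrow> - z \<in> rng_center"
  by (simp add: rng_center_def)

lemma rng_center_closed:
  assumes "z \<in> rng_center" "w \<in> rng_center"
  shows "z + w \<in> rng_center" "z - w \<in> rng_center" "z * w \<in> rng_center"
proof -
  show "z * w \<in> rng_center"
    by (rule rng_centerI) (metis assms rng_center_comm mult.assoc)
qed (use assms in \<open>simp_all add: rng_center_def distrib_left distrib_right left_diff_distrib right_diff_distrib\<close>)

lemma commutator_center [simp]:
  assumes "z \<in> rng_center"
  shows "commutator z x = 0" "commutator x z = 0"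
  using rng_center_comm[OF assms] by (simp_all add: commutator_def)

lemma rng_center_iff_commutator: "a \<in> rng_center \<longleftrightarrow> (\<forall>x. commutator a x = 0)"
  by (auto simp: rng_center_def commutator_def)

lemma commutator_add:
  "commutator (x + y) z = commutator x z + commutator y z"
  "commutator x (y + z) = commutator x y + commutator x z"
  "commutator (x - y) z = commutator x z - commutator y z"
  "commutator x (y - z) = commutator x y - commutator x z"
  by (simp_all add: commutator_def algebra_simps)

lemma commutator_mult:
  "commutator (x * y) z = commutator x z * y + x * commutator y z"
  "commutator x (y * z) = commutator x y * z + y * commutator x z"
  by (simp_all add: commutator_def algebra_simps)

lemma commutator_jordan_prod:
  "commutator (jordan_prod x y) z = jordan_prod (commutator x z) y + jordan_prod x (commutator y z)"
  "commutator x (jordan_prod y z) = jordan_prod (commutator x y) z + jordan_prod y (commutator x z)"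
  by (simp_all add: commutator_def jordan_prod_def algebra_simps)

lemma jordan_prod_add:
  "jordan_prod (x + y) z = jordan_prod x z + jordan_prod y z"
  "jordan_prod x (y + z) = jordan_prod x y + jordan_prod x z"
  "jordan_prod (x - y) z = jordan_prod x z - jordan_prod y z"
  "jordan_prod x (y - z) = jordan_prod x y - jordan_prod x z"
  by (simp_all add: jordan_prod_def algebra_simps)

section \<open>Prime rings of characteristic not two\<close>

lemma rng_char_not_2_double:
  fixes x :: "'a::ring" and R :: "'a itself"
  assumes prime: "prime_rng R" and char: "rng_char R \<noteq> 2" and "x + x = 0"
  shows "x = 0"
proof (rule ccontr)
  assume x: "x \<noteq> 0"
  \<comment> \<open>By primeness, one nonzero element killed by 2 forces the whole ring to be killed
    by 2. The numbers annihilating the ring are then exactly the even ones, and their gcd is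
    2.\<close>
  have two: "b + b = 0" for b :: 'a
  proof -
    have "x * y * (b + b) = (x + x) * y * b" for y by (simp add: algebra_simps)
    then show ?thesis using prime x assms(3) unfolding prime_rng_def by (metis mult_zero_left)
  qed
  let ?S = "{n::nat. \<forall>x::'a. (\<Sum>i<n. x) = 0}"
  have "n \<in> ?S \<longleftrightarrow> even n" for n :: nat
  proof (induction n rule: less_induct)
    case (less n)
    consider "n = 0" | "n = 1" | m where "n = Suc (Suc m)" by (metis One_nat_def not0_implies_Suc)
    then show ?case
    proof cases
      case 2 with x show ?thesis by auto
    next
      case 3
      have eq: "(\<Sum>i<n. y) = (\<Sum>i<m. y)" for y :: 'a
        by (simp add: 3 add.assoc two)
      have "n \<in> ?S \<longleftrightarrow> m \<in> ?S" by (simp only: mem_Collect_eq eq)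
      then show ?thesis using less.IH[of m] 3 by simp
    qed simp
  qed
  then have "?S = {n. even n}" by auto
  moreover have "Gcd {n::nat. even n} = 2"
    by (rule Gcd_eqI) auto
  ultimately show False using char by (simp add: rng_char_def)
qed

locale nonunital_prime =
  fixes R :: "'a::ring itself"
  assumes prime: "prime_rng R"
begin

lemma primeD: "(\<And>x. a * x * b = 0) \<Longrightarrow> a = 0 \<or> b = 0" for a b :: 'a
  using prime unfolding prime_rng_def by blast

lemma center_mult_eq_0:
  fixes z x :: 'a
  assumes "z \<in> rng_center" "z * x = 0"
  shows "z = 0 \<or> x = 0"
  using assms by (intro primeD) (metis rng_center_comm mult.assoc mult_zero_right)

lemma center_cancel:
  fixes z x :: 'a
  assumes "z \<in> rng_center" "z * x \<in> rng_center" "z \<noteq> 0"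
  shows "x \<in> rng_center"
proof -
  have "z * commutator x y = 0" for y
    using commutator_mult(1)[of z x y] by (simp add: assms)
  then show ?thesis using center_mult_eq_0[OF assms(1)] assms(3)
    unfolding rng_center_iff_commutator by blast
qed

lemma right_eq_0: "(\<And>x. a * x = 0) \<Longrightarrow> a = 0" for a :: 'a
  by (metis primeD mult.assoc mult_zero_right)

end

locale prime_rng_not_2 = nonunital_prime R for R :: "'a::ring itself" +
  assumes char: "rng_char R \<noteq> 2"
begin

lemma double_eq_0: "x + x = 0 \<Longrightarrow> x = 0" for x :: 'a
  using rng_char_not_2_double[OF prime char] .

lemma double_center: "x + x \<in> rng_center \<Longrightarrow> x \<in> rng_center" for x :: 'a
  unfolding rng_center_iff_commutator by (metis commutator_add(1) double_eq_0)

lemma jordan_prod_center: "z \<in> rng_center \<Longrightarrow> jordan_prod x z = 0 \<Longrightarrow> z = 0 \<or> x = 0" for z x :: 'a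
  by (metis center_mult_eq_0 double_eq_0 jordan_prod_def rng_center_comm distrib_left)

text \<open>The products \<open>c * r * c * s * c\<close> are antisymmetric in \<open>r\<close> and
  \<open>s\<close>, which forces longer products of this shape to vanish. Primeness then strips off
  factors until \<open>c = 0\<close>.\<close>

lemma square_zero_commutators:
  assumes sq: "\<And>x y::'a. commutator x y * commutator x y = 0"
  shows "commutator x y = (0::'a)"
proof -
  define c where "c = commutator x y"
  have cc: "c * c = 0" "c * (c * r) = 0" for r
    using sq by (simp_all add: c_def flip: mult.assoc)
  have 1: "c * r * c * r * c = 0" for r
  proof -
    \<comment> \<open>Of the four terms of the square, only \<open>r * c * r * c\<close> survives
      left multiplication by \<open>c\<close>.\<close>
    have "c * (commutator c r * commutator c r) = 0" using sq by simp
    then show ?thesis by (simp add: commutator_def algebra_simps cc)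
  qed
  have 2: "c * r * c * s * c = - (c * s * c * r * c)" for r s
    using 1[of "r + s"] 1[of r] 1[of s]
    by (simp add: distrib_left distrib_right add_eq_0_iff add.commute)
  \<comment> \<open>Moving \<open>s\<close> past the block \<open>r * c * t\<close> costs one sign,
    moving it past \<open>r\<close> and \<open>t\<close> separately costs two, so the product equals
    its own negative.\<close>
  have 3: "c * r * c * t * c * s * c = 0" for r s t
  proof (rule double_eq_0)
    have "c * (r * c * t) * c * s * c = - (c * s * c * (r * c * t) * c)" by (rule 2)
    also have "c * s * c * (r * c * t) * c = c * s * c * r * c * t * c" by (simp add: mult.assoc)
    also have "\<dots> = - (c * r * c * s * c) * t * c" by (simp only: 2[of s r])
    also have "\<dots> = - (c * r * (c * s * c * t * c))" by (simp add: mult.assoc)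
    also have "\<dots> = c * r * (c * t * c * s * c)" by (simp only: 2[of s t]) simp
    finally have "c * r * c * t * c * s * c = - (c * r * c * t * c * s * c)"
      by (simp add: mult.assoc)
    then show "c * r * c * t * c * s * c + c * r * c * t * c * s * c = 0"
      by (simp add: eq_neg_iff_add_eq_0)
  qed
  have "c * r * (c * t * c * s * c) = 0" for r s t using 3 by (simp add: mult.assoc)
  then have "c = 0 \<or> c * t * c * s * c = 0" for s t by (rule primeD)
  then have "c = 0 \<or> c * t * (c * s * c) = 0" for s t by (simp add: mult.assoc)
  then have "c = 0 \<or> c * s * c = 0" for s by (metis primeD)
  then show ?thesis by (metis primeD c_def)
qed

end

section \<open>The centralizing Jordan epimorphism \<open>G\<close>\<close>

locale commuting_jordan = prime_rng_not_2 R for R :: "'a::ring itself" +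
  fixes G :: "'a \<Rightarrow> 'a"
  assumes nc: "\<exists>x y :: 'a. x * y \<noteq> y * x"
    and epi: "CE_Jordan_epimorphism G"
    and centralizing: "\<And>x. commutator (G x) x \<in> rng_center"
begin

lemma G_add: "G (x + y) - G x - G y \<in> rng_center"
  and G_jordan: "G (jordan_prod x y) - jordan_prod (G x) (G y) \<in> rng_center"
  and G_surj: "surj G"
  using epi unfolding CE_Jordan_epimorphism_def CE_Jordan_endomorphism_def by auto

lemma commutator_G_add: "commutator (G (x + y)) z = commutator (G x) z + commutator (G y) z"
  using commutator_center(1)[OF G_add[of x y], of z] by (simp add: commutator_add algebra_simps)

lemma commutator_G_jordan: "commutator (G (jordan_prod x y)) z = commutator (jordan_prod (G x) (G y)) z"
  using commutator_center(1)[OF G_jordan[of x y], of z] by (simp add: commutator_add)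

text \<open>The direction \<open>jordan_prod x x\<close> is chosen because \<open>G\<close> sends it
  to \<open>jordan_prod (G x) (G x)\<close> up to the center. With c = [G x, x], all terms combine
  to 4 c (x + G x), which is therefore central.\<close>

lemma commuting: "commutator (G x) x = 0"
proof -
  let ?c = "commutator (G x) x"
  note c = centralizing[of x]
  let ?y = "jordan_prod x x"
  have "commutator (G (x + ?y)) (x + ?y) - ?c - commutator (G ?y) ?y \<in> rng_center"
    using centralizing by (intro rng_center_closed)
  then have "commutator (G x) ?y + commutator (G ?y) x \<in> rng_center"
    by (simp add: commutator_G_add commutator_add(2) add.commute)
  then have "jordan_prod ?c x + jordan_prod x ?c + (jordan_prod ?c (G x) + jordan_prod (G x) ?c) \<in> rng_center"
    by (simp only: commutator_G_jordan commutator_jordan_prod)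
  also have "jordan_prod ?c x + jordan_prod x ?c + (jordan_prod ?c (G x) + jordan_prod (G x) ?c) =
      (?c * (x + G x) + ?c * (x + G x)) + (?c * (x + G x) + ?c * (x + G x))"
    unfolding jordan_prod_def rng_center_comm[OF c, of x, symmetric] rng_center_comm[OF c, of "G x", symmetric]
    by (simp only: distrib_left ac_simps)
  finally have "?c * (x + G x) \<in> rng_center" by (rule double_center[OF double_center])
  then have "?c = 0 \<or> x + G x \<in> rng_center" using center_cancel c by blast
  \<comment> \<open>Hence the alternative that \<open>x + G x\<close> is central gives
    \<open>?c = 0\<close> as well.\<close>
  moreover have "?c = commutator (x + G x) x" by (simp add: commutator_def algebra_simps)
  ultimately show ?thesis by auto
qed

lemma commutator_G: "commutator (G x) y = commutator x (G y)"
  using commuting[of "x + y"] commuting[of x] commuting[of y]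
  by (simp add: commutator_G_add commutator_add(2)) (simp add: commutator_def algebra_simps)

section \<open>The difference \<open>H\<close> of \<open>G\<close> and the identity\<close>

definition H where "H x = G x - x"

lemma commutator_H: "commutator (H x) y = commutator x (H y)"
  using commutator_G[of x y] by (simp add: H_def commutator_add)

lemma commutator_H_self: "commutator (H x) x = 0"
  using commuting[of x] by (simp add: H_def commutator_def algebra_simps)

text \<open>Surjectivity gives \<open>p = G x\<close>. Then the commutator of \<open>p\<close> with
  \<open>jordan_prod y z\<close> equals that of \<open>x\<close> with
  \<open>jordan_prod (G y) (G z)\<close>. Expanding both by the Leibniz rule and moving
  \<open>G\<close> across the commutators leaves the identity as their difference.\<close>

lemma jordan_commutator_H:
  "jordan_prod (commutator p y) (H z) + jordan_prod (commutator p z) (H y) = 0"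
proof -
  obtain x where p: "p = G x" using G_surj by (metis surjD)
  have "commutator p (jordan_prod y z) = commutator x (jordan_prod (G y) (G z))"
  proof -
    have flip: "commutator x w = - commutator w x" for w by (simp add: commutator_def)
    have "commutator x (G (jordan_prod y z)) = commutator x (jordan_prod (G y) (G z))"
      by (simp only: flip[of "G _"] flip[of "jordan_prod _ _"] commutator_G_jordan)
    then show ?thesis by (simp only: p commutator_G)
  qed
  then have "jordan_prod (commutator p y) z + jordan_prod y (commutator p z) =
      jordan_prod (commutator p y) (G z) + jordan_prod (G y) (commutator p z)"
    by (simp add: commutator_jordan_prod p flip: commutator_G)
  then show ?thesis by (simp add: H_def jordan_prod_def algebra_simps)
qed

text \<open>The failure of additivity is central. By \<open>jordan_commutator_H\<close>, the Jordan
  product of [p, q] with \<open>H z\<close> is additive in \<open>z\<close>, so the defect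
  annihilates a nonzero commutator and must vanish.\<close>

lemma H_add: "H (x + y) = H x + H y"
proof -
  let ?z = "H (x + y) - H x - H y"
  have z: "?z \<in> rng_center" using G_add[of x y] by (simp add: H_def algebra_simps)
  obtain p q :: 'a where "commutator p q \<noteq> 0" using nc by (auto simp: commutator_def)
  moreover have "jordan_prod (commutator p q) ?z = 0"
  proof -
    have "jordan_prod (commutator p q) (H z) = - jordan_prod (commutator p z) (H q)" for z
      using jordan_commutator_H by (simp add: eq_neg_iff_add_eq_0)
    then show ?thesis by (simp only: jordan_prod_add commutator_add) simp
  qed
  ultimately have "?z = 0" using jordan_prod_center[OF z] by blast
  then show ?thesis by (simp add: algebra_simps)
qed

text \<open>Expand \<open>[x u, H (y v)] = [H (x u), y v]\<close> as a biderivation in its two arguments, in both orders.\<close>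

lemma H_proportional:
  "commutator x (H y) * w * commutator u v = commutator x y * w * commutator u (H v)"
proof -
  have der: "commutator x (H (y * v)) = commutator x (H y) * v + y * commutator x (H v)" for x y v
    by (simp add: commutator_mult flip: commutator_H)
  have 1: "commutator x (H y) * commutator u v = commutator x y * commutator u (H v)" for u
  proof -
    have "commutator (x * u) (H y) * v + y * commutator (x * u) (H v) =
      commutator x (H (y * v)) * u + x * commutator u (H (y * v))"
      unfolding der[symmetric] by (rule commutator_mult)
    then show ?thesis by (simp add: der commutator_mult(1)) (simp add: commutator_def algebra_simps)
  qed
  \<comment> \<open>Substituting \<open>w * u\<close> for \<open>u\<close> and subtracting the
    identity for \<open>w\<close>, multiplied by \<open>u\<close> on the right, inserts the middle
    factor.\<close>
  show ?thesis using 1[of "w * u"] 1[of w] by (simp add: commutator_mult(1) distrib_left flip: mult.assoc)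
qed

text \<open>As \<open>H y\<close> commutes with \<open>y\<close>, the case \<open>z = y\<close> of
  \<open>jordan_commutator_H\<close> says that \<open>jordan_prod p (H y)\<close> commutes with
  \<open>y\<close>. By proportionality it then commutes with \<open>H y\<close>, and its commutator
  with \<open>H y\<close> is that of \<open>p\<close> with \<open>H y * H y\<close>.\<close>

lemma H_square_center: "H y * H y \<in> rng_center"
proof -
  have "commutator (H y * H y) p = 0" for p
  proof -
    have "jordan_prod (commutator p y) (H y) = 0"
      using jordan_commutator_H[of p y y] by (rule double_eq_0)
    then have "commutator (jordan_prod p (H y)) y = 0"
      by (simp only: commutator_jordan_prod commutator_H_self) (simp add: jordan_prod_def)
    then have 0: "commutator (jordan_prod p (H y)) (H y) * w * commutator u v = 0" for u v w
      by (simp add: H_proportional)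
    obtain u v :: 'a where "commutator u v \<noteq> 0" using nc by (auto simp: commutator_def)
    then have "commutator (jordan_prod p (H y)) (H y) = 0" using primeD[OF 0] by blast
    then show ?thesis by (simp add: commutator_def jordan_prod_def algebra_simps)
  qed
  then show ?thesis unfolding rng_center_iff_commutator by blast
qed

lemma H_jordan_center: "jordan_prod (H x) (H y) \<in> rng_center"
proof -
  have "jordan_prod (H x) (H y) = H (x + y) * H (x + y) - H x * H x - H y * H y"
    by (simp add: H_add jordan_prod_def algebra_simps)
  then show ?thesis using H_square_center by (simp only: rng_center_closed)
qed

text \<open>For s = H x, t = H y and j = s t + t s, centrality of s^2, t^2 and j gives [s, t]^2 =
  j^2 - 4 s^2 t^2.\<close>

lemma H_commutator_square_center:
  "commutator (H x) (H y) * commutator (H x) (H y) \<in> rng_center"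
proof -
  define s t j where "s = H x" "t = H y" "j = jordan_prod (H x) (H y)"
  have j: "j \<in> rng_center" "s * s \<in> rng_center" "t * t \<in> rng_center"
    using H_jordan_center H_square_center by (auto simp: s_t_j_def)
  have ts: "t * s = j - s * t" by (simp add: s_t_j_def jordan_prod_def)
  have ts': "t * (s * r) = j * r - s * (t * r)" for r
    by (simp add: ts left_diff_distrib flip: mult.assoc)
  have js: "s * j = j * s" "t * j = j * t" using rng_center_comm[OF j(1)] by auto
  have js': "s * (j * r) = j * (s * r)" "t * (j * r) = j * (t * r)" for r
    using js by (simp_all flip: mult.assoc)
  let ?a = "(s * s) * (t * t)"
  have "commutator s t * commutator s t = j * j - (?a + ?a + ?a + ?a)"
    unfolding commutator_def
    by (simp add: distrib_left distrib_right left_diff_distrib right_diff_distrib mult.assoc ts ts' js js')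
  moreover have "?a \<in> rng_center" "j * j \<in> rng_center" using j rng_center_closed(3) by blast+
  ultimately show ?thesis unfolding s_t_j_def
    by (simp only: rng_center_closed)
qed

text \<open>\<open>H_proportional\<close> is applied twice, with \<open>commutator_H\<close> moving
  \<open>H\<close> between the arguments.\<close>

lemma H_commutator_proportional:
  "commutator (H x) (H y) * w * commutator u v = commutator x y * w * commutator (H u) (H v)"
  by (simp add: H_proportional commutator_H)

text \<open>Over the extended centroid \<open>[H x, H y]\<close> is \<open>\<lambda>\<^sup>2 [x, y]\<close> for a fixed \<open>\<lambda>\<close>; the fixed commutator
  \<open>[H a, H b]\<close> stands for \<open>\<lambda>\<^sup>2 [a, b]\<close> and makes \<open>\<lambda>\<close> superfluous.\<close>

lemma H_eq_0_or_hall: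
  "(\<forall>x. H x = 0) \<or> (\<forall>x y::'a. commutator x y * commutator x y \<in> rng_center)"
proof (cases "\<forall>a b. commutator (H a) (H b) = 0")
  case True
  \<comment> \<open>Here [x, H (H y)] = [H x, H y] = 0, so proportionality and primeness make every
    \<open>H y\<close> central.\<close>
  have 0: "commutator x (H y) * w * commutator u (H v) = 0" for x y u v w
    using H_proportional[of x "H y" w u v] True by (simp flip: commutator_H)
  have "commutator x (H y) = 0" for x y using primeD[OF 0, of x y x y] by blast
  then have Hy: "H y \<in> rng_center" for y
    unfolding rng_center_iff_commutator by (auto simp: commutator_def)
  obtain p q :: 'a where pq: "commutator p q \<noteq> 0" using nc by (auto simp: commutator_def)
  \<comment> \<open>The Jordan identity at \<open>y = z = q\<close> kills \<open>H q\<close>; its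
    term then drops out for arbitrary \<open>y\<close>.\<close>
  have Hq: "H q = 0"
    using jordan_commutator_H[of p q q] jordan_prod_center[OF Hy] pq double_eq_0 by blast
  have "H y = 0" for y
    using jordan_commutator_H[of p q y] jordan_prod_center[OF Hy] pq by (auto simp: Hq jordan_prod_def)
  then show ?thesis by blast
next
  case False
  note nz = this
  show ?thesis
  proof (cases "\<forall>a b. commutator (H a) (H b) * commutator (H a) (H b) = 0")
    \<comment> \<open>In this case all commutators turn out to have square zero, so Hall's identity
      holds trivially.\<close>
    case True
    from nz obtain a b where ab: "commutator (H a) (H b) \<noteq> 0" by blast
    define N M where "N = commutator a b" "M = commutator (H a) (H b)"
    have "commutator x y * commutator x y = 0" for x y :: 'a
    proof -
      define n m where "n = commutator x y" "m = commutator (H x) (H y)"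
      have m: "m * m = 0" using True by (simp add: n_m_def)
      have nm: "n * w * M = m * w * N" for w
        unfolding n_m_def N_M_def by (rule H_commutator_proportional[symmetric])
      have "n * m * w * M = 0" for w using nm[of "m * w"] m by (simp flip: mult.assoc)
      then have "n * m = 0" using primeD ab by (metis N_M_def(2))
      moreover have "n * n * w * M = n * m * w * N" for w using nm[of w] by (simp add: mult.assoc)
      ultimately show "n * n = 0" using primeD[of "n * n" M] ab by (simp add: N_M_def)
    qed
    then show ?thesis by (simp add: rng_center_0)
  next
    case False
    then obtain a b where ab: "commutator (H a) (H b) * commutator (H a) (H b) \<noteq> 0" by blast
    \<comment> \<open>As \<open>M\<close> is \<lambda>^2 \<open>N\<close>, the quotient of
      \<open>\<gamma>\<close> by \<open>\<beta>\<close> is \<lambda>^(-2). The equation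
      \<open>\<beta> * n = \<gamma> * m\<close> below thus expresses \<open>n\<close> through
      \<open>m\<close> without division.\<close>
    define N M \<beta> \<gamma> where NM: "N = commutator a b" "M = commutator (H a) (H b)"
      and \<beta>: "\<beta> = M * M" and \<gamma>: "\<gamma> = N * M"
    have \<beta>Z: "\<beta> \<in> rng_center" "\<beta> \<noteq> 0" using ab H_commutator_square_center by (auto simp: NM \<beta>)
    have cancel: "x = y" if "\<beta> * x = \<beta> * y" for x y
      using that center_mult_eq_0[OF \<beta>Z(1), of "x - y"] \<beta>Z(2) by (simp add: right_diff_distrib)
    have MN: "M * w * N = N * w * M" for w
      unfolding NM by (rule H_commutator_proportional)
    have \<gamma>Z: "\<gamma> \<in> rng_center"
    proof (rule rng_centerI, rule cancel)
      fix r
      have "\<beta> * (r * \<gamma>) = M * (M * r) * N * M" by (simp add: \<beta> \<gamma> mult.assoc)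
      also have "\<dots> = \<gamma> * r * \<beta>" by (simp only: MN) (simp add: \<beta> \<gamma> mult.assoc)
      finally show "\<beta> * (\<gamma> * r) = \<beta> * (r * \<gamma>)" using rng_center_comm[OF \<beta>Z(1)] by simp
    qed
    have MN': "M * N = \<gamma>"
      by (rule cancel) (metis MN \<gamma> \<beta>Z(1) mult.assoc rng_center_comm)
    have "commutator x y * commutator x y \<in> rng_center" for x y :: 'a
    proof -
      define n m where "n = commutator x y" "m = commutator (H x) (H y)"
      have nm: "n * w * M = m * w * N" for w
        unfolding n_m_def NM by (rule H_commutator_proportional[symmetric])
      have "(\<beta> * n - \<gamma> * m) * w = 0" for w
      proof -
        have "\<beta> * n * w = n * (w * M) * M"
          using rng_center_comm[OF \<beta>Z(1), of "n * w"] by (simp add: \<beta> mult.assoc)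
        also have "\<dots> = m * w * \<gamma>" by (simp only: nm) (simp add: MN' mult.assoc)
        also have "\<dots> = \<gamma> * m * w" using rng_center_comm[OF \<gamma>Z, of "m * w"] by (simp add: mult.assoc)
        finally show ?thesis by (simp add: left_diff_distrib)
      qed
      then have eq: "\<beta> * n = \<gamma> * m" using right_eq_0 by (metis eq_iff_diff_eq_0)
      have sq: "z * z * (c * c) = (z * c) * (z * c)" if "z \<in> rng_center" for z c :: 'a
        using rng_center_comm[OF that] by (metis mult.assoc)
      have "\<beta> * \<beta> * (n * n) = \<gamma> * \<gamma> * (m * m)"
        unfolding sq[OF \<beta>Z(1)] sq[OF \<gamma>Z] eq ..
      then have "\<beta> * \<beta> * (n * n) \<in> rng_center"
        using H_commutator_square_center \<gamma>Z by (simp add: n_m_def rng_center_closed)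
      moreover have "\<beta> * \<beta> \<noteq> 0" using center_mult_eq_0 \<beta>Z by blast
      ultimately show "n * n \<in> rng_center" using center_cancel[of "\<beta> * \<beta>"] \<beta>Z rng_center_closed(3) by blast
    qed
    then show ?thesis by blast
  qed
qed

end

section \<open>Hall's identity\<close>

locale hall_rng = prime_rng_not_2 R for R :: "'a::ring itself" +
  assumes nc: "\<exists>x y :: 'a. x * y \<noteq> y * x"
    and hall: "\<And>x y :: 'a. commutator x y * commutator x y \<in> rng_center"
begin

text \<open>Some commutator c = [x, y] has nonzero square. If \<open>c\<close> is central, [x, x y]
  = c x replaces it: this is noncentral because \<open>x\<close> is, and its square c^2 x^2 is
  nonzero because [x^2, y] = 2 c x excludes x^2 = 0.\<close>

lemma noncentral_commutator:
  obtains x y :: 'a where "commutator x y \<notin> rng_center" "commutator x y * commutator x y \<noteq> 0"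
proof -
  have "\<exists>x y::'a. commutator x y * commutator x y \<noteq> 0"
    using square_zero_commutators nc by (metis commutator_def eq_iff_diff_eq_0)
  then obtain x y :: 'a where xy: "commutator x y * commutator x y \<noteq> 0" by blast
  define c where "c = commutator x y"
  show thesis
  proof (cases "c \<in> rng_center")
    case False
    with xy that show ?thesis by (simp add: c_def)
  next
    case True
    have xc: "commutator x (x * y) = c * x"
      using rng_center_comm[OF True, of x] by (simp add: commutator_mult c_def commutator_def algebra_simps)
    have c: "c \<noteq> 0" using xy by (auto simp: c_def)
    have sq: "commutator x (x * y) * commutator x (x * y) = (c * c) * (x * x)"
      unfolding xc using rng_center_comm[OF True, of x] by (metis mult.assoc)
    have "x * x \<noteq> 0"
    proof
      assume "x * x = 0"
      then have "c * x + c * x = 0"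
        using commutator_mult(1)[of x x y] rng_center_comm[OF True, of x]
        by (simp add: c_def commutator_def)
      then have "c * x = 0" by (rule double_eq_0)
      then have "x = 0" using c center_mult_eq_0[OF True] by blast
      then show False using c by (simp add: c_def commutator_def)
    qed
    moreover have "c * c \<noteq> 0" using c center_mult_eq_0[OF True] by blast
    ultimately have "(c * c) * (x * x) \<noteq> 0"
      using center_mult_eq_0 rng_center_closed(3)[OF True True] by blast
    moreover have "c * x \<notin> rng_center"
    proof
      assume "c * x \<in> rng_center"
      then have "x \<in> rng_center" using center_cancel[OF True] c by blast
      then show False using c by (simp add: c_def)
    qed
    ultimately show ?thesis using that[of x "x * y"] sq xc by simp
  qed
qed

text \<open>For a noncentral commutator \<open>u\<close> with central nonzero square, every [u, w]
  anticommutes with \<open>u\<close>. If all of these had square zero, each v = [u, w] would satisfy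
  v r v = 0 for all \<open>r\<close>, making \<open>u\<close> central.\<close>

lemma anticommuting_pair:
  obtains u v :: 'a where "u * u \<in> rng_center" "u * u \<noteq> 0" "v * v \<in> rng_center" "v * v \<noteq> 0"
    "v * u = - (u * v)"
proof -
  obtain x y :: 'a where u: "commutator x y \<notin> rng_center" "commutator x y * commutator x y \<noteq> 0"
    by (rule noncentral_commutator)
  define u \<alpha> where "u = commutator x y" and \<alpha>: "\<alpha> = u * u"
  have \<alpha>Z: "\<alpha> \<in> rng_center" "\<alpha> \<noteq> 0" using u hall by (auto simp: u_def \<alpha>)
  have anti: "commutator u w * u = - (u * commutator u w)" for w
    using rng_center_comm[OF \<alpha>Z(1), of w] by (simp add: commutator_def \<alpha> algebra_simps)
  have "\<exists>w. commutator u w * commutator u w \<noteq> 0"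
  proof (rule ccontr)
    assume "\<not> ?thesis"
    then have sq: "commutator u w * commutator u w = 0" for w by blast
    \<comment> \<open>Every \<open>v\<close> anticommuting with \<open>u\<close> is a commutator up
      to a factor, since [u, u v] = 2 \<alpha> v.\<close>
    have V: "v * v = 0" if v: "v * u = - (u * v)" for v
    proof -
      have "commutator u (u * v) = \<alpha> * v + \<alpha> * v"
        using v by (simp add: commutator_def \<alpha> mult.assoc)
      then have "(\<alpha> * v + \<alpha> * v) * (\<alpha> * v + \<alpha> * v) = 0" using sq by metis
      moreover have "(\<alpha> * v + \<alpha> * v) * (\<alpha> * v + \<alpha> * v) = (\<alpha> * \<alpha> * (v * v) + \<alpha> * \<alpha> * (v * v)) + (\<alpha> * \<alpha> * (v * v) + \<alpha> * \<alpha> * (v * v))"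
        using rng_center_comm[OF \<alpha>Z(1), of v] by (simp add: distrib_left distrib_right mult.assoc) (metis mult.assoc)
      ultimately have "\<alpha> * (\<alpha> * (v * v)) = 0" using double_eq_0 by (metis mult.assoc)
      then show "v * v = 0" using \<alpha>Z center_mult_eq_0 by metis
    qed
    have "commutator u w = 0" for w
    proof -
      define v where "v = commutator u w"
      have v: "v * u = - (u * v)" "v * v = 0" using anti V by (auto simp: v_def)
      \<comment> \<open>Both \<open>c * v\<close> and \<open>c * v + v\<close> anticommute with
        \<open>u\<close>, so \<open>V\<close> applies to them.\<close>
      have 1: "v * c * v = 0" if c: "c * u = u * c" for c
      proof -
        have "c * v * u = - (u * (c * v))" using c v(1) by (metis mult.assoc mult_minus_right)
        then have "c * v * (c * v) = 0" "(c * v + v) * (c * v + v) = 0"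
          using v(1) by (auto intro: V simp add: distrib_left[of u] distrib_right[of _ _ u])
        then show ?thesis using v(2) by (simp add: distrib_left distrib_right mult.assoc)
      qed
      have 2: "v * w * v = 0" if w: "w * u = - (u * w)" for w
      proof -
        have "(w + v) * (w + v) = 0" using w v(1) by (intro V) (simp add: distrib_left distrib_right)
        then have "v * w = - (w * v)" using V[OF w] v(2) by (simp add: distrib_left distrib_right eq_neg_iff_add_eq_0 add.commute)
        then show ?thesis using v(2) by (simp add: mult.assoc)
      qed
      have "v * r * v = 0" for r
      proof -
        have a: "u * \<alpha> = \<alpha> * u" "r * \<alpha> = \<alpha> * r" "v * \<alpha> = \<alpha> * v" using rng_center_comm[OF \<alpha>Z(1)] by auto
        have ur: "u * (\<alpha> * s) = \<alpha> * (u * s)" "u * (u * s) = \<alpha> * s" "u * u = \<alpha>" for s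
          using a by (simp_all add: \<alpha> flip: mult.assoc)
        \<comment> \<open>These two elements split 2 \<alpha> r into a part commuting with
          \<open>u\<close> and a part anticommuting with it.\<close>
        have "v * (\<alpha> * r + u * r * u) * v = 0" "v * (\<alpha> * r - u * r * u) * v = 0"
          by (intro 1 2; simp add: algebra_simps ur a)+
        then have "v * (\<alpha> * r) * v + v * (\<alpha> * r) * v = 0"
          by (simp add: distrib_left distrib_right left_diff_distrib right_diff_distrib mult.assoc)
        then have "v * (\<alpha> * r) * v = 0" by (rule double_eq_0)
        then have "\<alpha> * (v * r * v) = 0" using a by (metis mult.assoc)
        then show ?thesis using \<alpha>Z center_mult_eq_0 by metis
      qed
      then show ?thesis using primeD unfolding v_def by blast
    qed
    then show False using u(1) unfolding rng_center_iff_commutator u_def by blast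
  qed
  then obtain w where w: "commutator u w * commutator u w \<noteq> 0" by blast
  show thesis
    by (rule that[of u "commutator u w"]) (use \<alpha>Z w hall anti in \<open>auto simp: \<alpha>\<close>)
qed

end

section \<open>Quaternion coordinates over the center\<close>

locale quaternion_rng = prime_rng_not_2 R for R :: "'a::ring itself" +
  fixes u v \<alpha> \<beta> :: 'a
  assumes hall: "\<And>x y :: 'a. commutator x y * commutator x y \<in> rng_center"
    and uu: "u * u = \<alpha>" and vv: "v * v = \<beta>" and vu: "v * u = - (u * v)"
    and \<alpha>: "\<alpha> \<in> rng_center" "\<alpha> \<noteq> 0" and \<beta>: "\<beta> \<in> rng_center" "\<beta> \<noteq> 0"
begin

lemma \<alpha>\<beta>: "\<alpha> * \<beta> \<in> rng_center" "\<alpha> * \<beta> \<noteq> 0"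
  using \<alpha> \<beta> center_mult_eq_0 rng_center_closed(3) by blast+

lemma assoc_rules: "u * (u * r) = \<alpha> * r" "v * (v * r) = \<beta> * r" "v * (u * r) = - (u * (v * r))"
  using uu vv vu by (simp_all flip: mult.assoc)

lemma comm_rules:
  "u * \<alpha> = \<alpha> * u" "u * \<beta> = \<beta> * u" "v * \<alpha> = \<alpha> * v" "v * \<beta> = \<beta> * v" "\<beta> * \<alpha> = \<alpha> * \<beta>"
  "u * (\<alpha> * r) = \<alpha> * (u * r)" "u * (\<beta> * r) = \<beta> * (u * r)"
  "v * (\<alpha> * r) = \<alpha> * (v * r)" "v * (\<beta> * r) = \<beta> * (v * r)" "\<beta> * (\<alpha> * r) = \<alpha> * (\<beta> * r)"
  by (metis \<alpha>(1) \<beta>(1) rng_center_comm mult.assoc)+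

lemma comm_rules':
  "x * \<alpha> = \<alpha> * x" "x * \<beta> = \<beta> * x" "x * (\<alpha> * r) = \<alpha> * (x * r)" "x * (\<beta> * r) = \<beta> * (x * r)"
  by (metis \<alpha>(1) \<beta>(1) rng_center_comm mult.assoc)+

lemmas quat_rules = uu vv vu assoc_rules comm_rules
lemmas ring_rules = distrib_left distrib_right left_diff_distrib right_diff_distrib mult.assoc

text \<open>Since [c u, v] = 2 c u v and (u v)^2 = -\<alpha>\<beta>, Hall's identity makes c^2
  central. The same for c + \<alpha>, with \<alpha> in the role of a unit, makes 2 \<alpha> c
  central.\<close>

lemma centralizer_central:
  assumes c: "c * u = u * c" "c * v = v * c"
  shows "c \<in> rng_center"
proof -
  have sq: "c * c \<in> rng_center" if c: "c * u = u * c" "c * v = v * c" for c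
  proof -
    have cr: "u * (c * r) = c * (u * r)" "v * (c * r) = c * (v * r)" for r
      using c by (simp_all flip: mult.assoc)
    let ?d = "c * (u * v)"
    have "commutator (c * u) v = ?d + ?d"
      by (simp add: commutator_def mult.assoc cr vu)
    then have "(?d + ?d) * (?d + ?d) \<in> rng_center" using hall by metis
    also have "(?d + ?d) * (?d + ?d) = (?d * ?d + ?d * ?d) + (?d * ?d + ?d * ?d)"
      by (simp add: distrib_left distrib_right)
    finally have "?d * ?d \<in> rng_center" by (rule double_center[OF double_center])
    also have "?d * ?d = - (\<alpha> * \<beta> * (c * c))"
      using comm_rules'[of c] by (simp add: ring_rules cr quat_rules)
    finally have "\<alpha> * \<beta> * (c * c) \<in> rng_center" using rng_center_minus by fastforce
    then show ?thesis using center_cancel[OF \<alpha>\<beta>(1)] \<alpha>\<beta>(2) by blast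
  qed
  have "(c + \<alpha>) * (c + \<alpha>) \<in> rng_center"
    by (rule sq) (use c in \<open>simp_all add: ring_rules quat_rules\<close>)
  moreover have "(c + \<alpha>) * (c + \<alpha>) = c * c + (\<alpha> * c + \<alpha> * c) + \<alpha> * \<alpha>"
    using comm_rules'(1)[of c] by (simp add: ring_rules)
  ultimately have "(c * c + (\<alpha> * c + \<alpha> * c) + \<alpha> * \<alpha>) - \<alpha> * \<alpha> - c * c \<in> rng_center"
    using sq[OF c] \<alpha>(1) rng_center_closed(2,3) by metis
  then have "\<alpha> * c + \<alpha> * c \<in> rng_center" by simp
  then show ?thesis using double_center center_cancel[OF \<alpha>(1)] \<alpha>(2) by blast
qed

text \<open>\<open>T x\<close> is \<open>\<alpha>\<beta>\<close> times the sum of the conjugates of \<open>x\<close> by \<open>1, u, v, u v\<close>, that is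
  \<open>4 \<alpha>\<beta>\<close> times the scalar component of \<open>x\<close>.\<close>

definition T where "T x = \<alpha> * \<beta> * x + \<beta> * (u * x * u) + \<alpha> * (v * x * v) - u * v * x * (u * v)"

text \<open>Conjugation by \<open>u\<close> or \<open>v\<close> permutes the four conjugates summed
  in \<open>T x\<close>, so \<open>T x\<close> commutes with both.\<close>

lemma T_central: "T x \<in> rng_center"
proof (rule centralizer_central)
  show "T x * u = u * T x" "T x * v = v * T x"
    using comm_rules'[of x] by (simp_all add: T_def ring_rules quat_rules)
qed

definition quad :: "'a \<Rightarrow> 'a" where "quad x = x + x + (x + x)"

definition \<kappa> where "\<kappa> = quad (\<alpha> * \<beta> * (\<alpha> * \<beta>))"

lemma quad_eq_0: "quad x = 0 \<Longrightarrow> x = 0"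
  unfolding quad_def using double_eq_0 by blast

lemma \<kappa>: "\<kappa> \<in> rng_center" "\<kappa> \<noteq> 0"
proof -
  show "\<kappa> \<in> rng_center" unfolding \<kappa>_def quad_def by (intro rng_center_closed \<alpha> \<beta>)
  show "\<kappa> \<noteq> 0" unfolding \<kappa>_def using \<alpha>\<beta> center_mult_eq_0 quad_eq_0 by blast
qed

text \<open>The coordinates of \<open>x\<close> along 1, u, v, u v are the scalar components of x, x
  u, x v, x u v divided by the squares 1, \<alpha>, \<beta>, -\<alpha>\<beta> of the basis elements.
  \<open>\<kappa>\<close> clears the denominators.\<close>

lemma decomposition:
  "\<kappa> * x = \<alpha> * \<beta> * T x + \<beta> * T (x * u) * u + \<alpha> * T (x * v) * v + (- T (x * (u * v))) * (u * v)"
  using comm_rules'[of x] by (simp add: \<kappa>_def quad_def T_def ring_rules quat_rules)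

lemma decomposition_ex:
  obtains z0 z1 z2 z3 where "z0 \<in> rng_center" "z1 \<in> rng_center" "z2 \<in> rng_center" "z3 \<in> rng_center"
    "\<kappa> * x = z0 + z1 * u + z2 * v + z3 * (u * v)"
  by (rule that[OF _ _ _ _ decomposition]; intro rng_center_closed rng_center_minus \<alpha> \<beta> T_central)

text \<open>The quaternion conjugate of \<open>\<kappa> * s\<close> serves as \<open>t\<close>,
  because \<kappa> s t is then a norm. If the norm is zero, regularity gives t = 0; then
  \<open>s\<close> is central and can itself be taken for \<open>t\<close>.\<close>

lemma regular_central_multiple:
  fixes s :: 'a
  assumes s: "regular_element s"
  obtains t where "s * t = t * s" "s * t \<in> rng_center" "s * t \<noteq> 0"
proof -
  have s0: "s \<noteq> 0" using s \<alpha>(2) unfolding regular_element_def by (metis mult_zero_left)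
  obtain z0 z1 z2 z3 where z: "z0 \<in> rng_center" "z1 \<in> rng_center" "z2 \<in> rng_center" "z3 \<in> rng_center"
    and dec: "\<kappa> * s = z0 + z1 * u + z2 * v + z3 * (u * v)" by (rule decomposition_ex)
  define p where "p = z1 * u + z2 * v + z3 * (u * v)"
  have dec: "\<kappa> * s = z0 + p" using dec by (simp add: p_def add.assoc)
  have scal: "z * a * (w * b) = z * w * (a * b)" if "w \<in> rng_center" for z w a b :: 'a
  proof -
    have "z * a * (w * b) = z * (a * w) * b" by (simp add: mult.assoc)
    also have "\<dots> = z * w * (a * b)" by (simp only: rng_center_comm[OF that, of a, symmetric] mult.assoc)
    finally show ?thesis .
  qed
  have zw: "z2 * z1 = z1 * z2" "z3 * z1 = z1 * z3" "z3 * z2 = z2 * z3" using z rng_center_comm by blast+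
  \<comment> \<open>The mixed terms cancel because u, v and u v anticommute pairwise.\<close>
  have "p * p = z1 * z1 * \<alpha> + z2 * z2 * \<beta> - z3 * z3 * (\<alpha> * \<beta>)"
    unfolding p_def distrib_left distrib_right scal[OF z(2)] scal[OF z(3)] scal[OF z(4)] zw
    by (simp add: mult.assoc quat_rules)
  then have pp: "p * p \<in> rng_center" using z \<alpha> \<beta> by (simp add: rng_center_closed)
  have z0p: "p * z0 = z0 * p" using rng_center_comm[OF z(1)] by simp
  define t where "t = z0 - p"
  have "\<kappa> * (s * t) = \<kappa> * s * t" by (simp add: mult.assoc)
  then have "\<kappa> * (s * t) = z0 * z0 - p * p"
    using z0p by (simp add: t_def dec distrib_right right_diff_distrib)
  moreover have "\<kappa> * (t * s) = t * (\<kappa> * s)" using rng_center_comm[OF \<kappa>(1)] by (metis mult.assoc)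
  then have "\<kappa> * (t * s) = z0 * z0 - p * p"
    using z0p by (simp add: t_def dec distrib_left left_diff_distrib)
  ultimately have "\<kappa> * (s * t - t * s) = 0" and *: "\<kappa> * (s * t) \<in> rng_center"
    using z(1) pp by (simp_all add: right_diff_distrib rng_center_closed)
  then have "s * t - t * s = 0" using center_mult_eq_0[OF \<kappa>(1)] \<kappa>(2) by blast
  then have st: "s * t = t * s" "s * t \<in> rng_center"
    using center_cancel[OF \<kappa>(1) *] \<kappa>(2) by simp_all
  show thesis
  proof (cases "s * t = 0")
    case False
    with st that show ?thesis by blast
  next
    case True
    then have "t = 0" using s unfolding regular_element_def by blast
    then have "p = z0" by (simp add: t_def)
    then have "\<kappa> * s \<in> rng_center" unfolding dec using z(1) rng_center_closed(1) by blast
    then have "s \<in> rng_center" using center_cancel[OF \<kappa>(1)] \<kappa>(2) by blast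
    then show ?thesis using that[of s] s0 center_mult_eq_0 rng_center_closed(3) by blast
  qed
qed

end

section \<open>Central localization\<close>

text \<open>Each further generator either raises the dimension by one or lies in the span already
  and leaves it unchanged.\<close>

lemma (in ring) dimension_Span_le:
  assumes K: "subfield K R" and "set Us \<subseteq> carrier R"
  shows "\<exists>n\<le>length Us. dimension n K (Span K Us)"
  using assms(2)
proof (induction Us)
  case Nil
  then show ?case by auto
next
  case (Cons x Us)
  then obtain n where n: "n \<le> length Us" "dimension n K (Span K Us)" and x: "x \<in> carrier R" by auto
  show ?case
  proof (cases "x \<in> Span K Us")
    case False
    with n x show ?thesis by (auto intro!: exI[of _ "Suc n"] Suc_dim)
  next
    case True
    note sub = space_subgroup_props[OF K n(2)]
    have "Span K (x # Us) \<subseteq> Span K Us"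
    proof
      fix y assume "y \<in> Span K (x # Us)"
      then obtain k w where "k \<in> K" "w \<in> Span K Us" "y = k \<otimes> x \<oplus> w"
        by (auto simp: line_extension_mem_iff)
      then show "y \<in> Span K Us" using sub(3)[OF sub(5)[OF _ True]] by blast
    qed
    moreover have "Span K Us \<subseteq> Span K (x # Us)"
    proof
      fix y assume y: "y \<in> Span K Us"
      have "y = \<zero> \<otimes> x \<oplus> y" using x y sub(1) by auto
      then show "y \<in> Span K (x # Us)"
        using y subfieldE(1)[OF K] subringE(2) by (auto simp: line_extension_mem_iff)
    qed
    ultimately show ?thesis using n by (intro exI[of _ n]) auto
  qed
qed

section \<open>Fractions with nonzero central denominators\<close>

context nonunital_prime
begin

definition nzc :: "'a set" where "nzc = rng_center - {0}"

text \<open>The fraction \<open>r z\<^sup>-\<^sup>1\<close>, as the set of all its representations.\<close>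

definition fraction :: "'a \<Rightarrow> 'a \<Rightarrow> ('a \<times> 'a) set"
  where "fraction r z = {(s, w). w \<in> nzc \<and> s * z = r * w}"

text \<open>This is the fraction of \<open>r * z\<close> over \<open>z\<close> for every
  \<open>z\<close> in \<open>nzc\<close>, written so that no \<open>z\<close> has to be
  chosen.\<close>

definition emb :: "'a \<Rightarrow> ('a \<times> 'a) set"
  where "emb r = {(s, w). w \<in> nzc \<and> s = r * w}"

text \<open>The unions run over all representations of the two arguments, and all their members are
  the same set. The element type is the one prescribed in
  \<open>order_in_csa_of_dim\<close>.\<close>

definition loc :: "('a \<times> 'a) set ring"
  where "loc = \<lparr>
    carrier = {fraction r z | r z. z \<in> nzc},
    monoid.mult = \<lambda>p q. \<Union>(r, z)\<in>p. \<Union>(s, w)\<in>q. fraction (r * s) (z * w),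
    monoid.one = {(z, w). w \<in> nzc \<and> z = w},
    ring.zero = emb 0,
    ring.add = \<lambda>p q. \<Union>(r, z)\<in>p. \<Union>(s, w)\<in>q. fraction (r * w + s * z) (z * w)\<rparr>"

lemma nzc_comm: "z \<in> nzc \<Longrightarrow> x * z = z * x"
  by (simp add: nzc_def rng_center_comm)

lemma nzc_left_comm: "z \<in> nzc \<Longrightarrow> x * (z * y) = z * (x * y)"
  by (metis nzc_comm mult.assoc)

lemma nzc_mult: "z \<in> nzc \<Longrightarrow> w \<in> nzc \<Longrightarrow> z * w \<in> nzc"
  using center_mult_eq_0 by (auto simp: nzc_def rng_center_closed)

lemma nzc_cancel: "z \<in> nzc \<Longrightarrow> z * x = z * y \<Longrightarrow> x = y"
  using center_mult_eq_0[of z "x - y"] by (auto simp: nzc_def right_diff_distrib)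

lemma nzc_cancel_right: "z \<in> nzc \<Longrightarrow> x * z = y * z \<Longrightarrow> x = y"
  by (metis nzc_cancel nzc_comm)

lemma nzc_ac:
  "z \<in> nzc \<Longrightarrow> w \<in> nzc \<Longrightarrow> z * w = w * z"
  "z \<in> nzc \<Longrightarrow> w \<in> nzc \<Longrightarrow> z * (w * x) = w * (z * x)"
  by (rule nzc_comm nzc_left_comm, assumption)+

text \<open>Nonzero central elements cancel, so equality of cross products is transitive and both
  fractions have the same representations.\<close>

lemma fraction_eqI:
  assumes "z \<in> nzc" "w \<in> nzc" "r * w = s * z"
  shows "fraction r z = fraction s w"
proof -
  have *: "t * w = s * y" if "z \<in> nzc" "w \<in> nzc" "y \<in> nzc" "r * w = s * z" "t * z = r * y" for t y r s z w
  proof (rule nzc_cancel[OF that(1)])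
    have "z * (t * w) = t * z * w" by (simp add: mult.assoc nzc_left_comm[OF that(1), of t])
    also have "\<dots> = r * w * y" unfolding that(5) by (simp add: mult.assoc nzc_comm[OF that(2), of y])
    also have "\<dots> = z * (s * y)" unfolding that(4) by (simp add: mult.assoc nzc_left_comm[OF that(1), of s])
    finally show "z * (t * w) = z * (s * y)" .
  qed
  have "t * z = r * y \<longleftrightarrow> t * w = s * y" if "y \<in> nzc" for t y
    using *[OF assms(1,2) that assms(3)] *[OF assms(2,1) that assms(3)[symmetric]] by blast
  then show ?thesis unfolding fraction_def by blast
qed

lemma fraction_mem: "z \<in> nzc \<Longrightarrow> (r, z) \<in> fraction r z"
  by (simp add: fraction_def)

lemma fraction_memD: "(s, w) \<in> fraction r z \<Longrightarrow> w \<in> nzc \<and> s * z = r * w"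
  by (simp add: fraction_def)

lemma fraction_eq_iff: "z \<in> nzc \<Longrightarrow> w \<in> nzc \<Longrightarrow> fraction r z = fraction s w \<longleftrightarrow> r * w = s * z"
  using fraction_eqI fraction_mem fraction_memD by blast

lemma fraction_extend: "z \<in> nzc \<Longrightarrow> w \<in> nzc \<Longrightarrow> fraction (r * w) (z * w) = fraction r z"
  by (simp add: fraction_eq_iff nzc_mult mult.assoc nzc_ac)

lemma emb_eq_fraction:
  assumes z: "z \<in> nzc"
  shows "emb r = fraction (r * z) z"
proof -
  have "s * z = r * z * w \<longleftrightarrow> s = r * w" for s w
    using nzc_cancel_right[OF z, of s "r * w"] by (auto simp: mult.assoc nzc_comm[OF z, of w])
  then show ?thesis by (simp add: emb_def fraction_def)
qed

lemma carrier_loc: "p \<in> carrier loc \<longleftrightarrow> (\<exists>r z. z \<in> nzc \<and> p = fraction r z)"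
  by (auto simp: loc_def)

lemma fraction_carrier: "z \<in> nzc \<Longrightarrow> fraction r z \<in> carrier loc"
  by (auto simp: carrier_loc)

lemma fraction_mult:
  assumes "z \<in> nzc" "w \<in> nzc"
  shows "fraction r z \<otimes>\<^bsub>loc\<^esub> fraction s w = fraction (r * s) (z * w)"
proof -
  have "fraction (r' * s') (z' * w') = fraction (r * s) (z * w)"
    if "(r', z') \<in> fraction r z" "(s', w') \<in> fraction s w" for r' z' s' w'
  proof (rule fraction_eqI)
    have nz: "z' \<in> nzc" "w' \<in> nzc" and eq: "r' * z = r * z'" "s' * w = s * w'"
      using that fraction_memD by blast+
    show "z' * w' \<in> nzc" "z * w \<in> nzc" using nz assms nzc_mult by blast+
    have "r' * s' * (z * w) = (r' * z) * (s' * w)"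
      using assms by (simp add: mult.assoc nzc_left_comm[of z s'])
    also have "\<dots> = (r * z') * (s * w')" by (simp only: eq)
    also have "\<dots> = r * s * (z' * w')" using nz by (simp add: mult.assoc nzc_left_comm[of z' s])
    finally show "r' * s' * (z * w) = r * s * (z' * w')" .
  qed
  then have "(\<Union>(r', z')\<in>fraction r z. \<Union>(s', w')\<in>fraction s w. fraction (r' * s') (z' * w')) =
      (\<Union>(r', z')\<in>fraction r z. \<Union>(s', w')\<in>fraction s w. fraction (r * s) (z * w))" by (intro SUP_cong) auto
  also have "\<dots> = fraction (r * s) (z * w)" using fraction_mem assms by fastforce
  finally show ?thesis by (simp add: loc_def)
qed

lemma fraction_add:
  assumes "z \<in> nzc" "w \<in> nzc"
  shows "fraction r z \<oplus>\<^bsub>loc\<^esub> fraction s w = fraction (r * w + s * z) (z * w)"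
proof -
  have "fraction (r' * w' + s' * z') (z' * w') = fraction (r * w + s * z) (z * w)"
    if "(r', z') \<in> fraction r z" "(s', w') \<in> fraction s w" for r' z' s' w'
  proof (rule fraction_eqI)
    have nz: "z' \<in> nzc" "w' \<in> nzc" and eq: "r' * z = r * z'" "s' * w = s * w'"
      using that fraction_memD by blast+
    show "z' * w' \<in> nzc" "z * w \<in> nzc" using nz assms nzc_mult by blast+
    have "r' * w' * (z * w) = (r' * z) * (w' * w)" using assms nz by (simp add: mult.assoc nzc_ac)
    also have "\<dots> = (r * z') * (w' * w)" by (simp only: eq)
    also have "\<dots> = r * w * (z' * w')" using assms nz by (simp add: mult.assoc nzc_ac)
    finally have 1: "r' * w' * (z * w) = r * w * (z' * w')" .
    have "s' * z' * (z * w) = (s' * w) * (z' * z)" using assms nz by (simp add: mult.assoc nzc_ac)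
    also have "\<dots> = (s * w') * (z' * z)" by (simp only: eq)
    also have "\<dots> = s * z * (z' * w')" using assms nz by (simp add: mult.assoc nzc_ac)
    finally show "(r' * w' + s' * z') * (z * w) = (r * w + s * z) * (z' * w')"
      using 1 by (simp only: distrib_right)
  qed
  then have "(\<Union>(r', z')\<in>fraction r z. \<Union>(s', w')\<in>fraction s w. fraction (r' * w' + s' * z') (z' * w')) =
      (\<Union>(r', z')\<in>fraction r z. \<Union>(s', w')\<in>fraction s w. fraction (r * w + s * z) (z * w))" by (intro SUP_cong) auto
  also have "\<dots> = fraction (r * w + s * z) (z * w)" using fraction_mem assms by fastforce
  finally show ?thesis by (simp add: loc_def)
qed

lemma fraction_add_same:
  assumes "z \<in> nzc"
  shows "fraction r z \<oplus>\<^bsub>loc\<^esub> fraction s z = fraction (r + s) z"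
  by (simp add: fraction_add assms fraction_extend flip: distrib_right)

lemma fraction_one:
  assumes z: "z \<in> nzc"
  shows "fraction z z = \<one>\<^bsub>loc\<^esub>"
proof -
  have "s * z = z * w \<longleftrightarrow> s = w" for s w
    using nzc_cancel[OF z, of s w] by (auto simp: nzc_comm[OF z, of s] nzc_comm[OF z, of w])
  then show ?thesis by (auto simp: loc_def fraction_def)
qed

lemma fraction_zero: "z \<in> nzc \<Longrightarrow> fraction 0 z = \<zero>\<^bsub>loc\<^esub>"
  using emb_eq_fraction[of z 0] by (simp add: loc_def)

text \<open>Over one denominator, fractions are added by adding numerators. The ring axioms involve
  at most three elements at a time.\<close>

lemma common_denominator:
  assumes "p \<in> carrier loc" "q \<in> carrier loc" "t \<in> carrier loc"
  obtains r1 r2 r3 z where "z \<in> nzc" "p = fraction r1 z" "q = fraction r2 z" "t = fraction r3 z"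
proof -
  obtain r1 z1 r2 z2 r3 z3 where z: "z1 \<in> nzc" "z2 \<in> nzc" "z3 \<in> nzc"
    and eq: "p = fraction r1 z1" "q = fraction r2 z2" "t = fraction r3 z3"
    using assms by (auto simp: carrier_loc)
  have "p = fraction (r1 * (z2 * z3)) (z1 * (z2 * z3))" "q = fraction (r2 * (z1 * z3)) (z1 * (z2 * z3))"
    "t = fraction (r3 * (z1 * z2)) (z1 * (z2 * z3))"
    unfolding eq using z by (simp_all add: fraction_eq_iff nzc_mult mult.assoc nzc_ac)
  with that show thesis using z nzc_mult by blast
qed

lemma ring_loc:
  assumes "nzc \<noteq> {}"
  shows "ring loc"
proof (rule ringI)
  obtain e where e: "e \<in> nzc" using assms by blast
  show "abelian_group loc"
  proof (rule abelian_groupI)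
    fix p q t assume pqt: "p \<in> carrier loc" "q \<in> carrier loc" "t \<in> carrier loc"
    from pqt obtain r1 r2 r3 z where z: "z \<in> nzc" "p = fraction r1 z" "q = fraction r2 z" "t = fraction r3 z"
      by (rule common_denominator)
    show "p \<oplus>\<^bsub>loc\<^esub> q \<in> carrier loc" using z by (simp add: fraction_add_same fraction_carrier)
    show "p \<oplus>\<^bsub>loc\<^esub> q \<oplus>\<^bsub>loc\<^esub> t = p \<oplus>\<^bsub>loc\<^esub> (q \<oplus>\<^bsub>loc\<^esub> t)"
      using z by (simp add: fraction_add_same add.assoc)
    show "p \<oplus>\<^bsub>loc\<^esub> q = q \<oplus>\<^bsub>loc\<^esub> p" using z by (simp add: fraction_add_same add.commute)
    show "\<zero>\<^bsub>loc\<^esub> \<oplus>\<^bsub>loc\<^esub> p = p" using z by (simp add: fraction_add_same flip: fraction_zero[OF z(1)])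
    have "fraction (- r1) z \<oplus>\<^bsub>loc\<^esub> p = \<zero>\<^bsub>loc\<^esub>" using z by (simp add: fraction_add_same fraction_zero)
    then show "\<exists>q\<in>carrier loc. q \<oplus>\<^bsub>loc\<^esub> p = \<zero>\<^bsub>loc\<^esub>" using fraction_carrier z(1) by blast
  next
    show "\<zero>\<^bsub>loc\<^esub> \<in> carrier loc" using fraction_carrier e by (simp flip: fraction_zero[OF e])
  qed
  show "Group.monoid loc"
  proof (rule monoidI)
    fix p q t assume "p \<in> carrier loc" "q \<in> carrier loc" "t \<in> carrier loc"
    then obtain r1 r2 r3 z where z: "z \<in> nzc" "p = fraction r1 z" "q = fraction r2 z" "t = fraction r3 z"
      by (rule common_denominator)
    show "p \<otimes>\<^bsub>loc\<^esub> q \<in> carrier loc" using z by (simp add: fraction_mult fraction_carrier nzc_mult)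
    show "p \<otimes>\<^bsub>loc\<^esub> q \<otimes>\<^bsub>loc\<^esub> t = p \<otimes>\<^bsub>loc\<^esub> (q \<otimes>\<^bsub>loc\<^esub> t)"
      using z by (simp add: fraction_mult nzc_mult mult.assoc)
    show "\<one>\<^bsub>loc\<^esub> \<otimes>\<^bsub>loc\<^esub> p = p" using z
      by (simp add: fraction_mult fraction_eq_iff nzc_mult mult.assoc nzc_left_comm[of z r1] flip: fraction_one[OF z(1)])
    show "p \<otimes>\<^bsub>loc\<^esub> \<one>\<^bsub>loc\<^esub> = p" using z
      by (simp add: fraction_mult fraction_eq_iff nzc_mult mult.assoc nzc_left_comm[of z r1] flip: fraction_one[OF z(1)])
  next
    show "\<one>\<^bsub>loc\<^esub> \<in> carrier loc" using fraction_carrier e by (simp flip: fraction_one[OF e])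
  qed
  fix p q t assume "p \<in> carrier loc" "q \<in> carrier loc" "t \<in> carrier loc"
  then obtain r1 r2 r3 z where z: "z \<in> nzc" "p = fraction r1 z" "q = fraction r2 z" "t = fraction r3 z"
    by (rule common_denominator)
  show "(p \<oplus>\<^bsub>loc\<^esub> q) \<otimes>\<^bsub>loc\<^esub> t = p \<otimes>\<^bsub>loc\<^esub> t \<oplus>\<^bsub>loc\<^esub> q \<otimes>\<^bsub>loc\<^esub> t"
    "t \<otimes>\<^bsub>loc\<^esub> (p \<oplus>\<^bsub>loc\<^esub> q) = t \<otimes>\<^bsub>loc\<^esub> p \<oplus>\<^bsub>loc\<^esub> t \<otimes>\<^bsub>loc\<^esub> q"
    using z by (simp_all add: fraction_add_same fraction_mult nzc_mult distrib_left distrib_right)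
qed

lemma fraction_emb_mult: "z \<in> nzc \<Longrightarrow> fraction r z \<otimes>\<^bsub>loc\<^esub> emb s = fraction (r * s) z"
  by (simp add: emb_eq_fraction[of z] fraction_mult fraction_extend flip: mult.assoc)

lemma emb_fraction_mult: "z \<in> nzc \<Longrightarrow> emb s \<otimes>\<^bsub>loc\<^esub> fraction r z = fraction (s * r) z"
  by (simp add: emb_eq_fraction[of z] fraction_mult fraction_eq_iff nzc_mult mult.assoc nzc_left_comm[of z r])

lemma emb_hom:
  assumes "nzc \<noteq> {}"
  shows "inj emb" "emb r \<in> carrier loc" "emb (r + s) = emb r \<oplus>\<^bsub>loc\<^esub> emb s" "emb (r * s) = emb r \<otimes>\<^bsub>loc\<^esub> emb s"
proof -
  obtain e where e: "e \<in> nzc" using assms by blast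
  show "inj emb"
  proof (rule injI)
    fix x y assume "emb x = emb y"
    then have "x * e * e = y * e * e" using e by (simp add: emb_eq_fraction[of e] fraction_eq_iff)
    then show "x = y" using nzc_cancel_right e by blast
  qed
  show "emb r \<in> carrier loc" using e by (simp add: emb_eq_fraction[of e] fraction_carrier)
  show "emb (r + s) = emb r \<oplus>\<^bsub>loc\<^esub> emb s" using e by (simp add: emb_eq_fraction[of e] fraction_add_same distrib_right)
  show "emb (r * s) = emb r \<otimes>\<^bsub>loc\<^esub> emb s"
    using e emb_fraction_mult[OF e, of r "s * e"] by (simp add: emb_eq_fraction[of e s] emb_eq_fraction[of e "r * s"] mult.assoc)
qed

lemma fraction_inverse:
  assumes "c \<in> nzc" "z \<in> nzc"
  shows "fraction c z \<otimes>\<^bsub>loc\<^esub> fraction z c = \<one>\<^bsub>loc\<^esub>" "fraction z c \<otimes>\<^bsub>loc\<^esub> fraction c z = \<one>\<^bsub>loc\<^esub>"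
  using assms by (simp_all add: fraction_mult nzc_comm[of c z] fraction_one nzc_mult)

text \<open>Commuting with every \<open>emb r\<close> already forces the numerator to be central,
  after cancelling the denominator.\<close>

lemma ring_center_loc: "ring_center loc = {fraction c z | c z. c \<in> rng_center \<and> z \<in> nzc}"
proof (intro equalityI subsetI)
  fix p assume p: "p \<in> ring_center loc"
  then obtain c z where c: "z \<in> nzc" "p = fraction c z" by (auto simp: ring_center_def carrier_loc)
  have "c * r = r * c" for r
  proof -
    have "emb r \<in> carrier loc" using c emb_hom(2) by blast
    then have "fraction c z \<otimes>\<^bsub>loc\<^esub> emb r = emb r \<otimes>\<^bsub>loc\<^esub> fraction c z"
      using p c(2) by (simp add: ring_center_def)
    then have "c * r * z = r * c * z" using c by (simp add: fraction_emb_mult emb_fraction_mult fraction_eq_iff)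
    then show ?thesis using nzc_cancel_right c by blast
  qed
  then show "p \<in> {fraction c z | c z. c \<in> rng_center \<and> z \<in> nzc}" using c rng_centerI by blast
next
  fix p assume "p \<in> {fraction c z | c z. c \<in> rng_center \<and> z \<in> nzc}"
  then obtain c z where c: "c \<in> rng_center" "z \<in> nzc" "p = fraction c z" by blast
  have "fraction c z \<otimes>\<^bsub>loc\<^esub> fraction r w = fraction r w \<otimes>\<^bsub>loc\<^esub> fraction c z" if "w \<in> nzc" for r w
    using that c by (simp add: fraction_mult nzc_comm[of z w] rng_center_comm[OF c(1)])
  then show "p \<in> ring_center loc" using c by (auto simp: ring_center_def carrier_loc)
qed

lemma center_loc_inverse:
  "p \<in> ring_center loc \<Longrightarrow> p \<noteq> \<zero>\<^bsub>loc\<^esub> \<Longrightarrow>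
    \<exists>q\<in>ring_center loc. p \<otimes>\<^bsub>loc\<^esub> q = \<one>\<^bsub>loc\<^esub> \<and> q \<otimes>\<^bsub>loc\<^esub> p = \<one>\<^bsub>loc\<^esub>"
proof -
  assume "p \<in> ring_center loc" "p \<noteq> \<zero>\<^bsub>loc\<^esub>"
  then obtain c z where cz: "c \<in> rng_center" "z \<in> nzc" "p = fraction c z"
    unfolding ring_center_loc by blast
  then have "c \<noteq> 0" using \<open>p \<noteq> \<zero>\<^bsub>loc\<^esub>\<close> fraction_zero by blast
  with cz have c: "c \<in> nzc" "z \<in> nzc" "p = fraction c z" by (auto simp: nzc_def)
  then show ?thesis unfolding ring_center_loc using fraction_inverse
    by (intro bexI[of _ "fraction z c"]) (auto simp: nzc_def)
qed

lemma subfield_center_loc: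
  assumes "nzc \<noteq> {}"
  shows "subfield (ring_center loc) loc"
proof -
  interpret A: ring loc by (rule ring_loc[OF assms])
  obtain e where e: "e \<in> nzc" using assms by blast
  have 01: "\<one>\<^bsub>loc\<^esub> \<noteq> \<zero>\<^bsub>loc\<^esub>"
    using e fraction_one[OF e] fraction_zero[OF e] fraction_eq_iff[OF e e, of e 0] nzc_mult[OF e e]
    by (auto simp: nzc_def)
  have car: "ring_center loc \<subseteq> carrier loc" by (auto simp: ring_center_def)
  have "subring (ring_center loc) loc"
  proof (rule A.subringI)
    show "\<ominus>\<^bsub>loc\<^esub> h \<in> ring_center loc" if "h \<in> ring_center loc" for h
      using that by (auto simp: ring_center_def A.l_minus A.r_minus)
    fix h k assume hk: "h \<in> ring_center loc" "k \<in> ring_center loc"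
    then have car: "h \<in> carrier loc" "k \<in> carrier loc" unfolding ring_center_def by blast+
    have comm: "h \<otimes>\<^bsub>loc\<^esub> x = x \<otimes>\<^bsub>loc\<^esub> h" "k \<otimes>\<^bsub>loc\<^esub> x = x \<otimes>\<^bsub>loc\<^esub> k" if "x \<in> carrier loc" for x
      using hk that unfolding ring_center_def by blast+
    have "h \<otimes>\<^bsub>loc\<^esub> k \<otimes>\<^bsub>loc\<^esub> x = x \<otimes>\<^bsub>loc\<^esub> (h \<otimes>\<^bsub>loc\<^esub> k)" if x: "x \<in> carrier loc" for x
      using comm[OF x] car x by (metis A.m_assoc)
    then show "h \<otimes>\<^bsub>loc\<^esub> k \<in> ring_center loc" using car A.m_closed unfolding ring_center_def by blast
    have "(h \<oplus>\<^bsub>loc\<^esub> k) \<otimes>\<^bsub>loc\<^esub> x = x \<otimes>\<^bsub>loc\<^esub> (h \<oplus>\<^bsub>loc\<^esub> k)" if x: "x \<in> carrier loc" for x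
      by (simp only: A.l_distr A.r_distr car x comm[OF x])
    then show "h \<oplus>\<^bsub>loc\<^esub> k \<in> ring_center loc" using car A.a_closed unfolding ring_center_def by blast
  next
    show "\<one>\<^bsub>loc\<^esub> \<in> ring_center loc" by (simp add: ring_center_def)
  qed (rule car)
  moreover have "h \<otimes>\<^bsub>loc\<^esub> k = k \<otimes>\<^bsub>loc\<^esub> h" if "h \<in> ring_center loc" "k \<in> ring_center loc" for h k
    using that unfolding ring_center_def by blast
  ultimately have "subcring (ring_center loc) loc" by (rule A.subcringI)
  then show ?thesis
  proof (rule A.subfieldI)
    show "Units (loc\<lparr>carrier := ring_center loc\<rparr>) = ring_center loc - {\<zero>\<^bsub>loc\<^esub>}"
    proof (intro equalityI subsetI)
      fix x assume "x \<in> Units (loc\<lparr>carrier := ring_center loc\<rparr>)"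
      then obtain y where x: "x \<in> ring_center loc" and y: "y \<in> ring_center loc" "y \<otimes>\<^bsub>loc\<^esub> x = \<one>\<^bsub>loc\<^esub>"
        by (auto simp: Units_def)
      have "x \<noteq> \<zero>\<^bsub>loc\<^esub>" using y 01 car A.r_null by (metis subsetD)
      with x show "x \<in> ring_center loc - {\<zero>\<^bsub>loc\<^esub>}" by blast
    next
      fix x assume "x \<in> ring_center loc - {\<zero>\<^bsub>loc\<^esub>}"
      then show "x \<in> Units (loc\<lparr>carrier := ring_center loc\<rparr>)"
        using center_loc_inverse[of x] unfolding Units_def by (simp, blast)
    qed
  qed
qed

end

section \<open>The localization as a central simple algebra\<close>

context quaternion_rng
begin

lemma nzc_nonempty: "nzc \<noteq> {}" using \<alpha> by (auto simp: nzc_def)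

lemma \<kappa>_nzc: "\<kappa> \<in> nzc" using \<kappa> by (simp add: nzc_def)

text \<open>A nonzero ideal contains \<open>emb x\<close> for some nonzero \<open>x\<close> and is
  stable under \<open>T\<close>. By \<open>decomposition\<close>, \<open>T\<close> is nonzero at one
  of x, x u, x v, x u v. That value is central, hence invertible in \<open>loc\<close>.\<close>

lemma simple_loc: "simple_ring loc"
proof -
  interpret A: ring loc by (rule ring_loc[OF nzc_nonempty])
  note hom = emb_hom[OF nzc_nonempty]
  have zero: "emb x = \<zero>\<^bsub>loc\<^esub> \<longleftrightarrow> x = 0" for x
    using hom(1) unfolding inj_def by (auto simp: loc_def)
  have "I = carrier loc" if I: "ideal I loc" and ne: "I \<noteq> {\<zero>\<^bsub>loc\<^esub>}" for I
  proof -
    interpret ideal I loc by (rule I)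
    have l: "emb (y * x) \<in> I" and r: "emb (x * y) \<in> I" if "emb x \<in> I" for x y
      unfolding hom(4) using that hom(2) by (auto intro: I_l_closed I_r_closed)
    have a: "emb (x + y) \<in> I" if "emb x \<in> I" "emb y \<in> I" for x y
      unfolding hom(3) using that by (rule additive_subgroup.a_closed[OF is_additive_subgroup])
    have d: "emb (x - y) \<in> I" if "emb x \<in> I" "emb y \<in> I" for x y
    proof -
      have "emb (x - y) = emb x \<ominus>\<^bsub>loc\<^esub> emb y"
        using hom(3)[of "x - y" y] hom(2) by (metis A.add.inv_solve_right a_minus_def diff_add_cancel)
      then show ?thesis using that
        by (simp add: a_minus_def additive_subgroup.a_inv_closed[OF is_additive_subgroup]
            additive_subgroup.a_closed[OF is_additive_subgroup])
    qed
    obtain p where p: "p \<in> I" "p \<noteq> \<zero>\<^bsub>loc\<^esub>"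
      using ne additive_subgroup.zero_closed[OF is_additive_subgroup] by blast
    then obtain x z where xz: "z \<in> nzc" "p = fraction x z" using Icarr carrier_loc by blast
    have "p \<otimes>\<^bsub>loc\<^esub> emb z = emb x"
      unfolding xz(2) fraction_emb_mult[OF xz(1)] emb_eq_fraction[OF xz(1), symmetric] ..
    then have xI: "emb x \<in> I" using p(1) hom(2) I_r_closed by metis
    have x0: "x \<noteq> 0" using p(2) xz fraction_zero by blast
    have TI: "emb (T y) \<in> I" if "emb y \<in> I" for y
      unfolding T_def by (intro a d l r that)
    have "\<exists>y. emb y \<in> I \<and> T y \<noteq> 0"
    proof (rule ccontr)
      assume "\<not> ?thesis"
      then have "T x = 0" "T (x * u) = 0" "T (x * v) = 0" "T (x * (u * v)) = 0"
        using xI r by blast+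
      then have "\<kappa> * x = 0" by (simp add: decomposition)
      then show False using center_mult_eq_0 \<kappa> x0 by blast
    qed
    then obtain y where y: "emb y \<in> I" "T y \<noteq> 0" by blast
    have Ty: "T y \<in> nzc" using T_central y by (simp add: nzc_def)
    \<comment> \<open>The second factor is the inverse of \<open>emb (T y)\<close>.\<close>
    have "emb (T y) \<otimes>\<^bsub>loc\<^esub> fraction (T y) (T y * T y) \<in> I"
      using TI[OF y(1)] by (intro I_r_closed) (auto intro: fraction_carrier nzc_mult Ty)
    then have "\<one>\<^bsub>loc\<^esub> \<in> I" using Ty by (simp add: emb_fraction_mult fraction_one nzc_mult)
    then show ?thesis by (rule one_imp_carrier)
  qed
  moreover have "carrier loc \<noteq> {\<zero>\<^bsub>loc\<^esub>}" using hom(2)[of \<alpha>] zero[of \<alpha>] \<alpha>(2) by auto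
  ultimately show ?thesis unfolding simple_ring_def using A.ring_axioms by blast
qed

text \<open>Dividing the coordinates by \<kappa> shows that 1, u, v, u v span \<open>loc\<close>
  over its center.\<close>

lemma dimension_loc: "\<exists>n\<le>4. ring.dimension loc n (ring_center loc) (carrier loc)"
proof -
  interpret A: ring loc by (rule ring_loc[OF nzc_nonempty])
  note hom = emb_hom[OF nzc_nonempty]
  let ?K = "ring_center loc" and ?U = "[\<one>\<^bsub>loc\<^esub>, emb u, emb v, emb (u * v)]"
  have U: "set ?U \<subseteq> carrier loc" using hom(2) by simp
  have K: "subfield ?K loc" by (rule subfield_center_loc[OF nzc_nonempty])
  have "p \<in> A.Span ?K ?U" if p: "p \<in> carrier loc" for p
  proof -
    obtain x z where xz: "z \<in> nzc" "p = fraction x z" using p by (auto simp: carrier_loc)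
    obtain z0 z1 z2 z3 where z: "z0 \<in> rng_center" "z1 \<in> rng_center" "z2 \<in> rng_center" "z3 \<in> rng_center"
      and dec: "\<kappa> * x = z0 + z1 * u + z2 * v + z3 * (u * v)" by (rule decomposition_ex)
    let ?w = "\<kappa> * z"
    have w: "?w \<in> nzc" using xz \<kappa>_nzc nzc_mult by blast
    let ?k = "[fraction z0 ?w, fraction z1 ?w, fraction z2 ?w, fraction z3 ?w]"
    \<comment> \<open>The final \<open>0\<close> is the empty combination, rewritten as a fraction
      over \<open>?w\<close>.\<close>
    have "A.combine ?k ?U = fraction (z0 + (z1 * u + (z2 * v + (z3 * (u * v) + 0)))) ?w"
      by (simp only: A.combine.simps A.r_one fraction_carrier[OF w] fraction_emb_mult[OF w]
          fraction_add_same[OF w] fraction_zero[OF w, symmetric])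
    also have "\<dots> = fraction (\<kappa> * x) ?w" unfolding dec by (simp add: add.assoc)
    also have "\<dots> = p" using xz \<kappa>_nzc w by (simp add: fraction_eq_iff nzc_left_comm[of \<kappa> x] mult.assoc)
    finally have "p = A.combine ?k ?U" ..
    moreover have "set ?k \<subseteq> ?K" using z w by (auto simp: ring_center_loc)
    ultimately show ?thesis unfolding A.Span_eq_combine_set_length_version[OF K U]
      by (intro CollectI exI[of _ ?k]) simp
  qed
  moreover have "A.Span ?K ?U \<subseteq> carrier loc" by (rule A.Span_in_carrier) (use U in \<open>auto simp: ring_center_def\<close>)
  ultimately have "A.Span ?K ?U = carrier loc" by blast
  then show ?thesis using A.dimension_Span_le[OF K U] by (simp add: numeral_eq_Suc)
qed

text \<open>A regular \<open>s\<close> divides a nonzero central \<open>s * t\<close>, whose inverse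
  in \<open>loc\<close> yields one for \<open>s\<close>. Central denominators are regular and serve
  on both sides.\<close>

lemma order_in_loc: "order_in emb loc"
proof -
  interpret A: ring loc by (rule ring_loc[OF nzc_nonempty])
  note hom = emb_hom[OF nzc_nonempty]
  \<comment> \<open>The ring may lack a unit, so the inverse of \<open>z\<close> is written as
    \<open>z\<close> over \<open>z * z\<close>.\<close>
  have cen: "emb z \<in> Units loc" "inv\<^bsub>loc\<^esub> (emb z) = fraction z (z * z)" if z: "z \<in> nzc" for z
  proof -
    have *: "emb z = fraction (z * z) z" using z by (rule emb_eq_fraction)
    note i = fraction_inverse[OF nzc_mult[OF z z] z]
    note c = fraction_carrier[OF z] fraction_carrier[OF nzc_mult[OF z z]]
    show u: "emb z \<in> Units loc" unfolding * Units_def using i c by blast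
    show "inv\<^bsub>loc\<^esub> (emb z) = fraction z (z * z)" unfolding * by (rule A.inv_unique'[symmetric]) (use i c in auto)
  qed
  have reg: "emb s \<in> Units loc" if s: "regular_element s" for s
  proof -
    obtain t where t: "s * t = t * s" "s * t \<in> rng_center" "s * t \<noteq> 0"
      using regular_central_multiple[OF s] by blast
    have u: "emb (s * t) \<in> Units loc" using t by (intro cen) (simp add: nzc_def)
    let ?i = "inv\<^bsub>loc\<^esub> (emb (s * t))"
    have car: "emb s \<in> carrier loc" "emb t \<in> carrier loc" "?i \<in> carrier loc" using hom(2) u by auto
    have 1: "emb s \<otimes>\<^bsub>loc\<^esub> (emb t \<otimes>\<^bsub>loc\<^esub> ?i) = \<one>\<^bsub>loc\<^esub>"
      using A.Units_r_inv[OF u] car by (simp only: hom(4) A.m_assoc)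
    have 2: "?i \<otimes>\<^bsub>loc\<^esub> emb t \<otimes>\<^bsub>loc\<^esub> emb s = \<one>\<^bsub>loc\<^esub>"
      using A.Units_l_inv[OF u] car by (simp only: t(1) hom(4) A.m_assoc)
    have "?i \<otimes>\<^bsub>loc\<^esub> emb t = emb t \<otimes>\<^bsub>loc\<^esub> ?i"
      by (rule A.inv_unique[OF 2 1 car(1)]) (intro A.m_closed car)+
    then show ?thesis unfolding Units_def using 1 2 car A.m_closed[OF car(2,3)]
      by (intro CollectI conjI bexI[of _ "emb t \<otimes>\<^bsub>loc\<^esub> ?i"]) simp_all
  qed
  have "\<exists>r s. regular_element s \<and> a = emb r \<otimes>\<^bsub>loc\<^esub> inv\<^bsub>loc\<^esub> (emb s)"
       "\<exists>t r. regular_element t \<and> a = inv\<^bsub>loc\<^esub> (emb t) \<otimes>\<^bsub>loc\<^esub> emb r" if a: "a \<in> carrier loc" for a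
  proof -
    obtain r z where rz: "z \<in> nzc" "a = fraction r z" using a by (auto simp: carrier_loc)
    have "x = 0" if "z * x = 0 \<or> x * z = 0" for x
      using that nzc_cancel[OF rz(1), of x 0] nzc_cancel_right[OF rz(1), of x 0] by auto
    then have "regular_element z" unfolding regular_element_def by blast
    moreover have "a = emb r \<otimes>\<^bsub>loc\<^esub> inv\<^bsub>loc\<^esub> (emb z)"
      using rz by (simp add: cen emb_fraction_mult nzc_mult fraction_extend)
    moreover have "a = inv\<^bsub>loc\<^esub> (emb z) \<otimes>\<^bsub>loc\<^esub> emb r"
      using rz by (simp add: cen fraction_emb_mult nzc_mult fraction_extend flip: nzc_comm)
    ultimately show "\<exists>r s. regular_element s \<and> a = emb r \<otimes>\<^bsub>loc\<^esub> inv\<^bsub>loc\<^esub> (emb s)"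
       "\<exists>t r. regular_element t \<and> a = inv\<^bsub>loc\<^esub> (emb t) \<otimes>\<^bsub>loc\<^esub> emb r" by blast+
  qed
  then show ?thesis unfolding order_in_def using A.ring_axioms hom reg by blast
qed

lemma order_in_csa: "\<exists>n\<le>4. order_in_csa_of_dim R n"
proof -
  obtain n where "n \<le> 4" "central_simple_algebra_of_dim n loc"
    using simple_loc dimension_loc subfield_center_loc[OF nzc_nonempty]
    unfolding central_simple_algebra_of_dim_def by blast
  then show ?thesis using order_in_loc unfolding order_in_csa_of_dim_def by blast
qed

end

theorem theorem3p6:
  fixes G :: "'a::ring \<Rightarrow> 'a"
  assumes "prime_rng TYPE('a)"
    and "\<exists>x y :: 'a. x * y \<noteq> y * x"
    and "rng_char TYPE('a) \<noteq> 2"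
    and "CE_Jordan_epimorphism G"
    and "\<And>x. commutator (G x) x \<in> rng_center"
  shows "(\<exists>n\<le>4. order_in_csa_of_dim TYPE('a) n) \<or>
    (\<exists>lam\<in>extended_centroid. \<forall>x. to_Q_mr (G x) = lam \<otimes>\<^bsub>Q_mr\<^esub> to_Q_mr x)"
proof -
  interpret commuting_jordan "TYPE('a)" G by unfold_locales (rule assms)+
  from H_eq_0_or_hall show ?thesis
  proof
    assume "\<forall>x. H x = 0"
    then have G: "G x = x" for x by (simp add: H_def)
    interpret Q: ring "Q_mr :: ('a set \<times> ('a \<Rightarrow> 'a)) set ring" by (rule ring_Q_mr[OF prime])
    have "\<one>\<^bsub>Q_mr\<^esub> \<in> (extended_centroid :: ('a set \<times> ('a \<Rightarrow> 'a)) set set)"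
      by (auto simp: extended_centroid_def ring_center_def)
    moreover have "\<forall>x. to_Q_mr (G x) = \<one>\<^bsub>Q_mr\<^esub> \<otimes>\<^bsub>Q_mr\<^esub> to_Q_mr x"
      using to_Q_mr_embedding(2)[OF prime] by (simp add: G)
    ultimately show ?thesis by blast
  next
    assume hall: "\<forall>x y::'a. commutator x y * commutator x y \<in> rng_center"
    interpret hall_rng "TYPE('a)" by unfold_locales (use nc hall in auto)
    obtain u v :: 'a where "u * u \<in> rng_center" "u * u \<noteq> 0" "v * v \<in> rng_center" "v * v \<noteq> 0"
      "v * u = - (u * v)" by (rule anticommuting_pair)
    then interpret quaternion_rng "TYPE('a)" u v "u * u" "v * v" by unfold_locales (use hall in auto)
    show ?thesis using order_in_csa by blast
  qed
qed

end
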